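(* For each $z\in\{{\rm a},{\rm s}\}$, it is decidable, given a stack automaton (SA) $M$, whether $M$ satisfies $\sigma^z_M(n)\in O(1)$ or not.
   Context: **Stack automata.** A one-way nondeterministic stack automaton (SA) is a 6-tuple $M=(Q,\Sigma,\Gamma,\delta,q_0,F)$: $Q$ is a finite set of states; $\Sigma,\Gamma$ are the (finite) input and stack alphabets; $\Gamma$ contains two special symbols $\triangleright$ (bottom marker) and $\triangleleft$ (top marker), and $\Gamma_0=\Gamma\setminus\{\triangleright,\triangleleft\}$; $q_0\in Q$ is the initial state; $F\subseteq Q$ is the set of final states; $\delta$ is a nondeterministic transition function from $Q\times(\Sigma\cup\{\lambda\})\times\Gamma$ into subsets of $Q\times\{\mathtt{stay},\mathtt{push}(x),\mathtt{pop},-1,0,+1 \mid x\in\Gamma_0\}$ ($\lambda$ is the empty word). Write $(q,a,y)\to(p,\iota)$ for $(p,\iota)\in\delta(q,a,y)$. A configuration is a triple $c=(q,w,\gamma)$ with $q\in Q$ the current state, $w\in\Sigma^*$ the remaining input, and $\gamma\in \triangleright\Gamma_0^*\uparrow\Gamma_0^*\triangleleft$ or $\gamma\in\triangleright\Gamma_0^*\triangleleft\uparrow$, where $\uparrow\notin\Gamma$ marks the stack head, which scans the symbol directly preceding it. The stack size of $c$ is $\|c\|_\Gamma=|\gamma|-3$ (number of symbols of $\Gamma_0$ on the stack). Write relation $\vdash_w$: if $(q,a,x)\to(p,\iota)$ with $x\in\Gamma_0\cup\{\triangleright\}$, $a\in\Sigma\cup\{\lambda\}$, then for $u\in\Sigma^*$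 and $\gamma x\triangleleft\in\triangleright\Gamma_0^*\triangleleft$: $(q,au,\gamma x\uparrow\triangleleft)\vdash_w(p,u,\gamma x\uparrow\triangleleft)$ if $\iota=\mathtt{stay}$; $(q,au,\gamma x\uparrow\triangleleft)\vdash_w(p,u,\gamma xy\uparrow\triangleleft)$ if $\iota=\mathtt{push}(y)$; $(q,au,\gamma x\uparrow\triangleleft)\vdash_w(p,u,\gamma\uparrow\triangleleft)$ if $\iota=\mathtt{pop}$ and $x\ne\triangleright$. (These moves are undefined if the head is not at the topmost stack symbol.) Read relation $\vdash_r$: if $(q,a,x)\to(p,\iota)$ with $x\in\Gamma$, then for $u\in\Sigma^*$ and $\gamma_1x\gamma_2\in\triangleright\Gamma_0^*\triangleleft$: $(q,au,\gamma_1x\uparrow\gamma_2)\vdash_r(p,u,\gamma_1\uparrow x\gamma_2)$ if $\iota=-1$ and $x\neq\triangleright$; $(q,au,\gamma_1x\uparrow\gamma_2)\vdash_r(p,u,\gamma_1x\uparrow\gamma_2)$ if $\iota=0$; $(q,au,\gamma_1x\uparrow\gamma_2)\vdash_r(p,u,\gamma_1xy\uparrow\gamma_2')$ if $\iota=+1$ and $\gamma_2=y\gamma_2'$, $y\in\Gamma$. Let $\vdash=\vdash_w\cup\vdash_r$. A partial computation on $u\in\Sigma^*$ is a finite sequence of configurations $c_0\vdash\cdots\vdash c_m$ with $c_0=(q_0,u,\triangleright\uparrow\triangleleft)$. It is a computation if the remaining input in $c_m$ is $\lambda$, and an accepting computation if moreover the state of $c_m$ is in $F$. Its stack size is $\|\mathcal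 C\|_\Gamma=\max_j\|c_j\|_\Gamma$. The accepted language $L(M)$ is the set of words on which $M$ has an accepting computation. **Accept and strong space measures.** For $u\in\Sigma^*$: $\sigma^{\rm a}_M(u)$ is the maximum of $\|\mathcal C\|_\Gamma$ over accepting computations $\mathcal C$ of $M$ on $u$ if $u\in L(M)$ and this maximum exists, $\infty$ if $u\in L(M)$ and $M$ has accepting computations on $u$ of arbitrarily large stack size, and $0$ if $u\notin L(M)$. $\sigma^{\rm s}_M(u)$ is the maximum of $\|\mathcal C\|_\Gamma$ over all partial computations $\mathcal C$ of $M$ on $u$ if it exists, and $\infty$ otherwise. For $z\in\{{\rm a},{\rm s}\}$, $\sigma^z_M(n)=\max\{\sigma^z_M(u)\mid u\in\Sigma^*,|u|=n\}$. Convention: if $\sigma^z_M$ takes the value $\infty$ even for a single word, then $\sigma^z_M(n)$ is regarded as not being in $O(f(n))$ for any integer function $f$ (in particular not in $O(1)$). The input to the decision problem is a (finite) description of $M$. *)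

theory Defs
  imports Complex_Main "HOL-Library.Extended_Nat" "HOL-Library.Landau_Symbols"
    "HOL-Library.Nat_Bijection"
begin

section \<open>Stack automata\<close>

text \<open>\<open>Bot\<close> and \<open>Top\<close> are the bottom marker and the top marker; \<open>Sym\<close> injects the
  ordinary stack symbols (those of \<open>\<Gamma>\<^sub>0\<close>).\<close>

datatype 'g stksym = Bot | Top | Sym 'g

datatype 'g instr = Stay | Push 'g | Pop | MoveDown | MoveNone | MoveUp
  \<comment> \<open>the last three are the read instructions \<open>-1\<close>, \<open>0\<close>, \<open>+1\<close>\<close>

text \<open>The stack alphabet is given by \<open>\<Gamma>\<^sub>0\<close>. The transition function, with values in sets, is
  given by its graph: \<open>((q, a, y), (p, \<iota>)) \<in> transitions M\<close> stands for \<open>(q, a, y) \<rightarrow> (p, \<iota>)\<close>,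
  where \<open>a = None\<close> is the empty word.\<close>

record ('q, 'a, 'g) sa =
  states :: "'q set"
  inputs :: "'a set"
  stack0 :: "'g set"
  transitions :: "(('q \<times> 'a option \<times> 'g stksym) \<times> ('q \<times> 'g instr)) set"
  init   :: 'q
  finals :: "'q set"

definition stack_alphabet :: "('q, 'a, 'g) sa \<Rightarrow> 'g stksym set" where
  "stack_alphabet M = {Bot, Top} \<union> Sym ` stack0 M"

definition instrs :: "('q, 'a, 'g) sa \<Rightarrow> 'g instr set" where
  "instrs M = {Stay, Pop, MoveDown, MoveNone, MoveUp} \<union> Push ` stack0 M"

definition stack_automaton :: "('q, 'a, 'g) sa \<Rightarrow> bool" where
  "stack_automaton M \<longleftrightarrow>
     finite (states M) \<and> finite (inputs M) \<and> finite (stack0 M) \<and>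
     transitions M \<subseteq> (states M \<times> insert None (Some ` inputs M) \<times> stack_alphabet M)
                \<times> (states M \<times> instrs M) \<and>
     init M \<in> states M \<and> finals M \<subseteq> states M"

text \<open>A configuration \<open>(q, w, \<alpha>, \<beta>)\<close> has state \<open>q\<close>, remaining input \<open>w\<close> and stack
  \<open>\<alpha>\<close>, head marker, \<open>\<beta>\<close>; the head scans the last symbol of \<open>\<alpha>\<close>. The top of the
  stack is at the right end.\<close>

type_synonym ('q, 'a, 'g) config = "'q \<times> 'a list \<times> 'g stksym list \<times> 'g stksym list"

definition stacks :: "('q, 'a, 'g) sa \<Rightarrow> 'g stksym list set" where
  "stacks M = {Bot # map Sym g @ [Top] | g. set g \<subseteq> stack0 M}"

fun letter :: "'a option \<Rightarrow> 'a list" where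
  "letter None = []"
| "letter (Some a) = [a]"

inductive write_step ::
  "('q, 'a, 'g) sa \<Rightarrow> ('q, 'a, 'g) config \<Rightarrow> ('q, 'a, 'g) config \<Rightarrow> bool"
  for M where
  write_stay:
    "write_step M (q, letter a @ u, \<gamma> @ [x], [Top]) (p, u, \<gamma> @ [x], [Top])"
    if "((q, a, x), (p, Stay)) \<in> transitions M" "x \<in> insert Bot (Sym ` stack0 M)"
       "u \<in> lists (inputs M)" "\<gamma> @ [x, Top] \<in> stacks M"
| write_push:
    "write_step M (q, letter a @ u, \<gamma> @ [x], [Top]) (p, u, \<gamma> @ [x, Sym y], [Top])"
    if "((q, a, x), (p, Push y)) \<in> transitions M" "x \<in> insert Bot (Sym ` stack0 M)"
       "u \<in> lists (inputs M)" "\<gamma> @ [x, Top] \<in> stacks M"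
| write_pop:
    "write_step M (q, letter a @ u, \<gamma> @ [x], [Top]) (p, u, \<gamma>, [Top])"
    if "((q, a, x), (p, Pop)) \<in> transitions M" "x \<in> insert Bot (Sym ` stack0 M)" "x \<noteq> Bot"
       "u \<in> lists (inputs M)" "\<gamma> @ [x, Top] \<in> stacks M"

inductive read_step ::
  "('q, 'a, 'g) sa \<Rightarrow> ('q, 'a, 'g) config \<Rightarrow> ('q, 'a, 'g) config \<Rightarrow> bool"
  for M where
  read_down:
    "read_step M (q, letter a @ u, \<gamma>1 @ [x], \<gamma>2) (p, u, \<gamma>1, x # \<gamma>2)"
    if "((q, a, x), (p, MoveDown)) \<in> transitions M" "x \<noteq> Bot"
       "u \<in> lists (inputs M)" "\<gamma>1 @ [x] @ \<gamma>2 \<in> stacks M"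
| read_none:
    "read_step M (q, letter a @ u, \<gamma>1 @ [x], \<gamma>2) (p, u, \<gamma>1 @ [x], \<gamma>2)"
    if "((q, a, x), (p, MoveNone)) \<in> transitions M"
       "u \<in> lists (inputs M)" "\<gamma>1 @ [x] @ \<gamma>2 \<in> stacks M"
| read_up:
    "read_step M (q, letter a @ u, \<gamma>1 @ [x], y # \<gamma>2) (p, u, \<gamma>1 @ [x, y], \<gamma>2)"
    if "((q, a, x), (p, MoveUp)) \<in> transitions M"
       "u \<in> lists (inputs M)" "\<gamma>1 @ [x] @ y # \<gamma>2 \<in> stacks M"

definition step ::
  "('q, 'a, 'g) sa \<Rightarrow> ('q, 'a, 'g) config \<Rightarrow> ('q, 'a, 'g) config \<Rightarrow> bool" where
  "step M c c' \<longleftrightarrow> write_step M c c' \<or> read_step M c c'"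

definition partial_computation ::
  "('q, 'a, 'g) sa \<Rightarrow> 'a list \<Rightarrow> ('q, 'a, 'g) config list \<Rightarrow> bool" where
  "partial_computation M u cs \<longleftrightarrow>
     cs \<noteq> [] \<and> hd cs = (init M, u, [Bot], [Top]) \<and> successively (step M) cs"

definition computation ::
  "('q, 'a, 'g) sa \<Rightarrow> 'a list \<Rightarrow> ('q, 'a, 'g) config list \<Rightarrow> bool" where
  "computation M u cs \<longleftrightarrow> partial_computation M u cs \<and> fst (snd (last cs)) = []"

definition accepting_computation ::
  "('q, 'a, 'g) sa \<Rightarrow> 'a list \<Rightarrow> ('q, 'a, 'g) config list \<Rightarrow> bool" where
  "accepting_computation M u cs \<longleftrightarrow> computation M u cs \<and> fst (last cs) \<in> finals M"

definition accepted_language :: "('q, 'a, 'g) sa \<Rightarrow> 'a list set" where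
  "accepted_language M = {u \<in> lists (inputs M). \<exists>cs. accepting_computation M u cs}"


section \<open>Space measures\<close>

text \<open>Both end markers are part of \<open>\<alpha> @ \<beta>\<close> and are not counted; the head marker is not
  represented, hence \<open>2\<close> rather than \<open>3\<close>.\<close>

fun stack_size :: "('q, 'a, 'g) config \<Rightarrow> nat" where
  "stack_size (q, w, \<alpha>, \<beta>) = length \<alpha> + length \<beta> - 2"

definition comp_size :: "('q, 'a, 'g) config list \<Rightarrow> nat" where
  "comp_size cs = Max (stack_size ` set cs)"

datatype measure_kind = Accept | Strong

text \<open>A supremum in \<^typ>\<open>enat\<close> of a nonempty set of natural numbers is its maximum if
  there is one and \<open>\<infinity>\<close> otherwise.\<close>

fun word_space :: "measure_kind \<Rightarrow> ('q, 'a, 'g) sa \<Rightarrow> 'a list \<Rightarrow> enat" where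
  "word_space Accept M u =
     (if u \<in> accepted_language M
      then (SUP cs \<in> {cs. accepting_computation M u cs}. enat (comp_size cs)) else 0)"
| "word_space Strong M u =
     (SUP cs \<in> {cs. partial_computation M u cs}. enat (comp_size cs))"

text \<open>The value is \<open>0\<close> if there is no word of length \<open>n\<close>, i.e. for an empty input alphabet
  and \<open>n > 0\<close>.\<close>

definition sa_space :: "measure_kind \<Rightarrow> ('q, 'a, 'g) sa \<Rightarrow> nat \<Rightarrow> enat" where
  "sa_space z M n = (SUP u \<in> {u \<in> lists (inputs M). length u = n}. word_space z M u)"

text \<open>A function that takes the value \<open>\<infinity>\<close> is in no class \<open>O(f)\<close>.\<close>

definition enat_bigo :: "(nat \<Rightarrow> enat) \<Rightarrow> (nat \<Rightarrow> real) \<Rightarrow> bool" where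
  "enat_bigo s f \<longleftrightarrow> (\<forall>n. s n \<noteq> \<infinity>) \<and> (\<lambda>n. real (the_enat (s n))) \<in> O(f)"


section \<open>Recursive functions and decidable sets\<close>

text \<open>\<open>recursive n f\<close>: on argument lists of length \<open>n\<close>, \<open>f\<close> is a total recursive
  function. These are generated by composition, primitive recursion and minimization of regular
  functions (those where the search always succeeds); by Kleene's normal form theorem, they are
  exactly the total functions among the partial recursive ones. The values of \<open>f\<close> on lists of
  other lengths have no meaning, and none of the rules uses them.\<close>

inductive recursive :: "nat \<Rightarrow> (nat list \<Rightarrow> nat) \<Rightarrow> bool" where
  rec_zero: "recursive n (\<lambda>xs. 0)"
| rec_succ: "recursive 1 (\<lambda>xs. Suc (hd xs))"
| rec_proj: "i < n \<Longrightarrow> recursive n (\<lambda>xs. xs ! i)"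
| rec_comp: "recursive (length gs) f \<Longrightarrow> \<forall>g \<in> set gs. recursive n g \<Longrightarrow>
    recursive n (\<lambda>xs. f (map (\<lambda>g. g xs) gs))"
| rec_prim: "recursive n f \<Longrightarrow> recursive (Suc (Suc n)) g \<Longrightarrow>
    recursive (Suc n) (\<lambda>xs. rec_nat (f (tl xs)) (\<lambda>y r. g (y # r # tl xs)) (hd xs))"
| rec_min: "recursive (Suc n) f \<Longrightarrow> \<forall>xs. length xs = n \<longrightarrow> (\<exists>y. f (y # xs) = 0) \<Longrightarrow>
    recursive n (\<lambda>xs. LEAST y. f (y # xs) = 0)"

definition decidable :: "nat set \<Rightarrow> bool" where
  "decidable A \<longleftrightarrow> (\<exists>f. recursive 1 f \<and> (\<forall>n. f [n] = (if n \<in> A then 1 else 0)))"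


section \<open>Finite descriptions of stack automata\<close>

text \<open>States and symbols are named by natural numbers, and each finite set of the automaton is
  given by a list of its elements. Up to renaming, every stack automaton has such a description.\<close>

datatype sa_desc = Desc
  (d_states: "nat list") (d_inputs: "nat list") (d_stack0: "nat list")
  (d_trans: "((nat \<times> nat option \<times> nat stksym) \<times> (nat \<times> nat instr)) list")
  (d_init: nat) (d_finals: "nat list")

definition sa_of :: "sa_desc \<Rightarrow> (nat, nat, nat) sa" where
  "sa_of D = \<lparr>states = set (d_states D), inputs = set (d_inputs D), stack0 = set (d_stack0 D),
     transitions = set (d_trans D), init = d_init D, finals = set (d_finals D)\<rparr>"

fun encode_option :: "nat option \<Rightarrow> nat" where
  "encode_option None = 0"
| "encode_option (Some a) = Suc a"

fun encode_stksym :: "nat stksym \<Rightarrow> nat" where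
  "encode_stksym Bot = 0"
| "encode_stksym Top = 1"
| "encode_stksym (Sym x) = x + 2"

fun encode_instr :: "nat instr \<Rightarrow> nat" where
  "encode_instr Stay = 0"
| "encode_instr Pop = 1"
| "encode_instr MoveDown = 2"
| "encode_instr MoveNone = 3"
| "encode_instr MoveUp = 4"
| "encode_instr (Push x) = x + 5"

fun encode_trans :: "(nat \<times> nat option \<times> nat stksym) \<times> (nat \<times> nat instr) \<Rightarrow> nat" where
  "encode_trans ((q, a, x), (p, i)) =
     list_encode [q, encode_option a, encode_stksym x, p, encode_instr i]"

definition encode_desc :: "sa_desc \<Rightarrow> nat" where
  "encode_desc D = list_encode
     [list_encode (d_states D), list_encode (d_inputs D), list_encode (d_stack0 D),
      list_encode (map encode_trans (d_trans D)), d_init D, list_encode (d_finals D)]"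

lemma inj_encode_option: "inj encode_option"
  by (rule injI, metis encode_option.elims nat.distinct(1) nat.inject)

lemma inj_encode_stksym: "inj encode_stksym"
proof (rule injI)
  fix x y show "encode_stksym x = encode_stksym y \<Longrightarrow> x = y" by (cases x; cases y) auto
qed

lemma inj_encode_instr: "inj encode_instr"
proof (rule injI)
  fix x y show "encode_instr x = encode_instr y \<Longrightarrow> x = y" by (cases x; cases y) auto
qed

lemma inj_encode_trans: "inj encode_trans"
proof (rule injI)
  fix x y show "encode_trans x = encode_trans y \<Longrightarrow> x = y"
    by (cases x rule: encode_trans.cases; cases y rule: encode_trans.cases)
      (auto simp: inj_eq[OF inj_encode_option] inj_eq[OF inj_encode_stksym]
        inj_eq[OF inj_encode_instr])
qed

lemma inj_encode_desc: "inj encode_desc"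
proof (rule injI)
  fix D E assume "encode_desc D = encode_desc E"
  then show "D = E"
    by (cases D; cases E)
      (auto simp: encode_desc_def list_encode_eq inj_map_eq_map[OF inj_encode_trans])
qed

end

theory Submission
  imports Defs
begin

text \<open>Since only the existence of computations matters, the input can be dropped: the space is
  unbounded iff the input-free transition graph has paths to final states (for the accept measure)
  or to arbitrary states (for the strong measure) of arbitrarily large maximal stack size.

  What a reading excursion into a stack content can do depends only on a finite summary of it, and
  the summary after a push is a function of the summary before. So the possible behaviours of runs
  that start at the top of a stack and have room for exactly \<open>d\<close> more symbols form a finite set
  \<open>G\<^sub>d\<close> over a fixed finite universe, with \<open>G\<^bsub>d+1\<^esub> = F(G\<^sub>d)\<close>. Whether a run of maximal stack
  size exactly \<open>N\<close> exists can be read off \<open>G\<^sub>N\<close>. If \<open>K\<close> bounds the number of possible values,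
  the sequence is periodic from some index at most \<open>K\<close> on with a period at most \<open>K\<close>, so the sizes
  are unbounded iff some size between \<open>K\<close> and \<open>2K\<close> occurs. This is a reachability question in the
  finite graph of configurations of stack size at most \<open>2K\<close>.\<close>

section \<open>Computable functions\<close>

text \<open>The decision procedure never computes the \<open>level\<close> sets; they only show that
  the window from K to 2K is conclusive. The obstacle is that a stack automaton can reread its whole
  stack, so a return relation indexed by the top symbol, as for pushdown automata, does not describe
  what happens between a push and its pop. Summaries, in the style of Shepherdson's tables for
  two-way finite automata, take the place of the top symbol. Indexing behaviours by the room left,
  and not by the height, lets one map act at every height. Demanding that the maximum be exactly the
  available size turns unboundedness into a property of infinitely many single terms of one
  sequence, which periodicity can decide. Each configuration carries the maximum so far, so that the
  size of a run can be seen from the node it reaches.\<close>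

text \<open>Unlike \<^const>\<open>recursive\<close>, this only speaks about argument lists of the right length, so
  that functions may be replaced without regard to junk values such as \<open>hd []\<close>.\<close>

definition recf :: "nat \<Rightarrow> (nat list \<Rightarrow> nat) \<Rightarrow> bool" where
  "recf n f \<longleftrightarrow> (\<exists>g. recursive n g \<and> (\<forall>xs. length xs = n \<longrightarrow> g xs = f xs))"

lemma recf_cong: "recf n f \<Longrightarrow> (\<And>xs. length xs = n \<Longrightarrow> f xs = g xs) \<Longrightarrow> recf n g"
  unfolding recf_def by (elim exE conjE) (rule exI, auto)

lemma recf_comp:
  assumes "recf (length gs) f" "\<forall>g \<in> set gs. recf n g"
  shows "recf n (\<lambda>xs. f (map (\<lambda>g. g xs) gs))"
proof -
  obtain f' where f': "recursive (length gs) f'" "\<And>xs. length xs = length gs \<Longrightarrow> f' xs = f xs"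
    using assms(1) by (auto simp: recf_def)
  obtain h where h: "\<And>g. g \<in> set gs \<Longrightarrow> recursive n (h g) \<and> (\<forall>xs. length xs = n \<longrightarrow> h g xs = g xs)"
    using assms(2) unfolding recf_def by metis
  have "recursive n (\<lambda>xs. f' (map (\<lambda>g. g xs) (map h gs)))"
    by (rule rec_comp) (use f'(1) h in auto)
  moreover have "f' (map (\<lambda>g. g xs) (map h gs)) = f (map (\<lambda>g. g xs) gs)" if "length xs = n" for xs
  proof -
    have "map (\<lambda>g. g xs) (map h gs) = map (\<lambda>g. g xs) gs" using h that by simp
    then show ?thesis using f'(2)[of "map (\<lambda>g. g xs) gs"] by (simp only: length_map)
  qed
  ultimately show ?thesis unfolding recf_def by blast
qed

lemma recf_proj: "i < n \<Longrightarrow> recf n (\<lambda>xs. xs ! i)"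
  unfolding recf_def using rec_proj by blast

lemma recf_comp1: "recf 1 (\<lambda>xs. f (xs ! 0)) \<Longrightarrow> recf n g \<Longrightarrow> recf n (\<lambda>xs. f (g xs))"
  using recf_comp[of "[g]" "\<lambda>xs. f (xs ! 0)" n] by simp

lemma recf_comp2:
  "recf 2 (\<lambda>xs. f (xs ! 0) (xs ! 1)) \<Longrightarrow> recf n g \<Longrightarrow> recf n h \<Longrightarrow> recf n (\<lambda>xs. f (g xs) (h xs))"
  using recf_comp[of "[g, h]" "\<lambda>xs. f (xs ! 0) (xs ! 1)" n] by (simp add: numeral_2_eq_2)

lemma recf_Suc: "recf n g \<Longrightarrow> recf n (\<lambda>xs. Suc (g xs))"
proof (rule recf_comp1[where f = Suc])
  show "recf 1 (\<lambda>xs. Suc (xs ! 0))" unfolding recf_def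
    by (rule exI[of _ "\<lambda>xs. Suc (hd xs)"]) (use rec_succ in \<open>auto simp: length_Suc_conv\<close>)
qed

lemma recf_const: "recf n (\<lambda>_. k)"
proof (induction k)
  case 0
  show ?case unfolding recf_def using rec_zero by blast
next
  case (Suc k)
  then show ?case by (rule recf_Suc)
qed

lemma recf_prim:
  assumes "recf n f" "recf (Suc (Suc n)) (\<lambda>ys. g (ys ! 0) (ys ! 1) (drop 2 ys))" "recf n k"
  shows "recf n (\<lambda>xs. rec_nat (f xs) (\<lambda>y r. g y r xs) (k xs))"
proof -
  obtain f' where f': "recursive n f'" "\<And>xs. length xs = n \<Longrightarrow> f' xs = f xs"
    using assms(1) by (auto simp: recf_def)
  obtain g' where g': "recursive (Suc (Suc n)) g'"
    "\<And>ys. length ys = Suc (Suc n) \<Longrightarrow> g' ys = g (ys ! 0) (ys ! 1) (drop 2 ys)"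
    using assms(2) by (auto simp: recf_def)
  define F where "F = (\<lambda>xs. rec_nat (f' (tl xs)) (\<lambda>y r. g' (y # r # tl xs)) (hd xs))"
  have "recursive (Suc n) F" unfolding F_def by (rule rec_prim) fact+
  then have F: "recf (Suc n) F" unfolding recf_def by blast
  \<comment> \<open>The projections pass all parameters on, so composing with \<open>?gs\<close>
    feeds \<open>k xs # xs\<close> to \<open>F\<close>; \<open>rec_prim\<close> recurses on the
    first argument only.\<close>
  let ?gs = "k # map (\<lambda>i xs. xs ! i) [0..<n]"
  have "recf n (\<lambda>xs. F (map (\<lambda>g. g xs) ?gs))"
    by (rule recf_comp) (use F assms(3) recf_proj in auto)
  then show ?thesis
  proof (rule recf_cong)
    fix xs :: "nat list" assume l: "length xs = n"
    have "map (\<lambda>g. g xs) ?gs = k xs # xs" using l by (auto simp: comp_def intro: nth_equalityI)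
    moreover have "rec_nat (f' xs) (\<lambda>y r. g' (y # r # xs)) m = rec_nat (f xs) (\<lambda>y r. g y r xs) m" for m
      by (induction m) (use l f'(2) g'(2) in auto)
    ultimately show "F (map (\<lambda>g. g xs) ?gs) = rec_nat (f xs) (\<lambda>y r. g y r xs) (k xs)"
      by (simp only: F_def list.sel)
  qed
qed

lemma recf_least:
  assumes "recf (Suc n) (\<lambda>ys. f (ys ! 0) (tl ys))" "\<And>xs. length xs = n \<Longrightarrow> \<exists>y. f y xs = 0"
  shows "recf n (\<lambda>xs. LEAST y. f y xs = 0)"
proof -
  obtain g where g: "recursive (Suc n) g" "\<And>ys. length ys = Suc n \<Longrightarrow> g ys = f (ys ! 0) (tl ys)"
    using assms(1) by (auto simp: recf_def)
  have "recursive n (\<lambda>xs. LEAST y. g (y # xs) = 0)"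
    by (rule rec_min) (use g assms(2) in auto)
  then show ?thesis unfolding recf_def using g(2) by auto
qed

lemma recf_pred: "recf n f \<Longrightarrow> recf n (\<lambda>xs. f xs - 1)"
proof (rule recf_comp1[where f = "\<lambda>x. x - 1"])
  have "recf 1 (\<lambda>xs. rec_nat 0 (\<lambda>y r. y) (xs ! 0))"
    by (rule recf_prim[where g = "\<lambda>y r xs. y"]) (auto intro: recf_const recf_proj)
  moreover have "rec_nat 0 (\<lambda>y r. y) m = m - 1" for m :: nat by (cases m) auto
  ultimately show "recf 1 (\<lambda>xs. xs ! 0 - 1)" by simp
qed

lemma recf_diff: "recf n f \<Longrightarrow> recf n g \<Longrightarrow> recf n (\<lambda>xs. f xs - g xs)"
proof (rule recf_comp2[where f = "(-)"])
  have "recf 2 (\<lambda>xs. rec_nat (xs ! 0) (\<lambda>y r. r - 1) (xs ! 1))"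
    by (rule recf_prim[where g = "\<lambda>y r xs. r - 1"]) (auto intro!: recf_proj recf_pred[simplified])
  moreover have "rec_nat a (\<lambda>y r. r - 1) m = a - m" for a m :: nat by (induction m) auto
  ultimately show "recf 2 (\<lambda>xs. xs ! 0 - xs ! 1)" by simp
qed

lemma recf_add: "recf n f \<Longrightarrow> recf n g \<Longrightarrow> recf n (\<lambda>xs. f xs + g xs)"
proof (rule recf_comp2[where f = "(+)"])
  have "recf 2 (\<lambda>xs. rec_nat (xs ! 0) (\<lambda>y r. Suc r) (xs ! 1))"
    by (rule recf_prim[where g = "\<lambda>y r xs. Suc r"]) (auto intro!: recf_proj recf_Suc)
  moreover have "rec_nat a (\<lambda>y r. Suc r) m = a + m" for a m :: nat by (induction m) auto
  ultimately show "recf 2 (\<lambda>xs. xs ! 0 + xs ! 1)" by simp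
qed

lemma recf_triangle: "recf n f \<Longrightarrow> recf n (\<lambda>xs. triangle (f xs))"
proof (rule recf_comp1[where f = triangle])
  have "recf 1 (\<lambda>xs. rec_nat 0 (\<lambda>y r. r + Suc y) (xs ! 0))"
    by (rule recf_prim[where g = "\<lambda>y r xs. r + Suc y"])
      (auto intro!: recf_const recf_proj recf_Suc recf_add simp del: add_Suc_right)
  moreover have "rec_nat 0 (\<lambda>y r. r + Suc y) m = triangle m" for m :: nat
    by (induction m) auto
  ultimately show "recf 1 (\<lambda>xs. triangle (xs ! 0))" by simp
qed

section \<open>Cantor pairing and its projections\<close>

definition pfst :: "nat \<Rightarrow> nat" where "pfst z = fst (prod_decode z)"
definition psnd :: "nat \<Rightarrow> nat" where "psnd z = snd (prod_decode z)"

lemma pfst_encode [simp]: "pfst (prod_encode (a, b)) = a"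
  and psnd_encode [simp]: "psnd (prod_encode (a, b)) = b"
  by (simp_all add: pfst_def psnd_def)

lemma prod_encode_pfst_psnd: "prod_encode (pfst z, psnd z) = z"
  by (simp add: pfst_def psnd_def)

text \<open>The pair \<open>(a, b)\<close> lies on the antidiagonal \<open>a + b\<close> of Cantor's
  pairing, the only \<open>w\<close> with \<open>triangle w \<le> z < triangle (Suc w)\<close>. The
  strict inequality is written as a vanishing truncated difference, the form that minimization can
  test.\<close>

definition diagonal :: "nat \<Rightarrow> nat" where
  "diagonal z = (LEAST w. Suc z - triangle (Suc w) = 0)"

lemma triangle_mono: "m \<le> n \<Longrightarrow> triangle m \<le> triangle n"
  by (induction n) (auto simp: le_Suc_eq)

lemma diagonal_encode: "diagonal (prod_encode (a, b)) = a + b"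
  unfolding diagonal_def
proof (rule Least_equality)
  show "Suc (prod_encode (a, b)) - triangle (Suc (a + b)) = 0" by (simp add: prod_encode_def)
  fix w assume "Suc (prod_encode (a, b)) - triangle (Suc w) = 0"
  then have "prod_encode (a, b) < triangle (Suc w)" by simp
  moreover have "triangle (Suc w) \<le> triangle (a + b)" if "w < a + b"
    using that by (intro triangle_mono) simp
  ultimately show "a + b \<le> w" by (force simp: prod_encode_def)
qed

lemma pfst_eq: "pfst z = z - triangle (diagonal z)"
  using diagonal_encode[of "pfst z" "psnd z"] prod_encode_pfst_psnd[of z]
  by (simp add: prod_encode_def)

lemma psnd_eq: "psnd z = diagonal z - pfst z"
  using diagonal_encode[of "pfst z" "psnd z"] by (simp add: prod_encode_pfst_psnd)

lemma recf_diagonal: "recf n f \<Longrightarrow> recf n (\<lambda>xs. diagonal (f xs))"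
proof (rule recf_comp1[where f = diagonal])
  have "recf 1 (\<lambda>xs. LEAST w. Suc (xs ! 0) - triangle (Suc w) = 0)"
  proof (rule recf_least[where f = "\<lambda>w xs. Suc (xs ! 0) - triangle (Suc w)"])
    have "recf (Suc 1) (\<lambda>ys. Suc (ys ! 1) - triangle (Suc (ys ! 0)))"
      by (intro recf_diff recf_triangle recf_Suc recf_proj) auto
    then show "recf (Suc 1) (\<lambda>ys. Suc (tl ys ! 0) - triangle (Suc (ys ! 0)))"
      by (rule recf_cong) (simp add: nth_tl)
    have "Suc z - triangle (Suc (pfst z + psnd z)) = 0" for z
      using prod_encode_pfst_psnd[of z] by (simp add: prod_encode_def)
    then show "\<And>xs. \<exists>y. Suc (xs ! 0) - triangle (Suc y) = 0" by blast
  qed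
  then show "recf 1 (\<lambda>xs. diagonal (xs ! 0))" by (simp only: diagonal_def)
qed

section \<open>Closure properties of computable functions and decidable predicates\<close>

definition computable :: "(nat \<Rightarrow> nat) \<Rightarrow> bool" where
  "computable f \<longleftrightarrow> recf 1 (\<lambda>xs. f (xs ! 0))"

definition decpred :: "(nat \<Rightarrow> bool) \<Rightarrow> bool" where
  "decpred P \<longleftrightarrow> computable (\<lambda>x. if P x then 1 else 0)"

text \<open>Closure rules. Rules for operators that bind a variable (recursion, minimization, bounded
  quantifiers) code the bound variable and its context as a pair: \<^const>\<open>pfst\<close> is the bound
  variable, \<^const>\<open>psnd\<close> the context.\<close>

named_theorems comp_intros

lemma computable_ident [comp_intros]: "computable (\<lambda>x. x)"
  unfolding computable_def by (rule recf_proj) simp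

lemma computable_const [comp_intros]: "computable (\<lambda>x. k)"
  unfolding computable_def by (rule recf_const)

lemma computable_compose: "computable f \<Longrightarrow> computable g \<Longrightarrow> computable (\<lambda>x. f (g x))"
  unfolding computable_def by (rule recf_comp1)

lemma computable_Suc [comp_intros]: "computable f \<Longrightarrow> computable (\<lambda>x. Suc (f x))"
  unfolding computable_def by (rule recf_Suc)

lemma computable_add [comp_intros]: "computable f \<Longrightarrow> computable g \<Longrightarrow> computable (\<lambda>x. f x + g x)"
  unfolding computable_def by (rule recf_add)

lemma computable_diff [comp_intros]: "computable f \<Longrightarrow> computable g \<Longrightarrow> computable (\<lambda>x. f x - g x)"
  unfolding computable_def by (rule recf_diff)

lemma computable_pair [comp_intros]:
  "computable f \<Longrightarrow> computable g \<Longrightarrow> computable (\<lambda>x. prod_encode (f x, g x))"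
  unfolding computable_def prod_encode_def case_prod_conv by (intro recf_add recf_triangle)

lemma computable_pfst [comp_intros]: "computable f \<Longrightarrow> computable (\<lambda>x. pfst (f x))"
  unfolding computable_def pfst_eq by (intro recf_diff recf_triangle recf_diagonal)

lemma computable_psnd [comp_intros]: "computable f \<Longrightarrow> computable (\<lambda>x. psnd (f x))"
  unfolding psnd_eq using computable_pfst[of f]
  unfolding computable_def by (intro recf_diff recf_diagonal)

lemma computable_rec_nat [comp_intros]:
  assumes "computable f" "computable (\<lambda>z. s (pfst z) (pfst (psnd z)) (psnd (psnd z)))" "computable k"
  shows "computable (\<lambda>x. rec_nat (f x) (\<lambda>y r. s y r x) (k x))"
proof -
  have "recf 3 (\<lambda>ys. prod_encode (ys ! 0, prod_encode (ys ! 1, ys ! 2)))"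
    unfolding prod_encode_def case_prod_conv by (intro recf_add recf_triangle recf_proj) auto
  from recf_comp1[OF assms(2)[unfolded computable_def] this]
  have "recf 3 (\<lambda>ys. s (ys ! 0) (ys ! 1) (ys ! 2))" by simp
  then have *: "recf (Suc (Suc 1)) (\<lambda>ys. s (ys ! 0) (ys ! 1) (drop 2 ys ! 0))"
    by (simp add: numeral_3_eq_3) (rule recf_cong, assumption, simp)
  show ?thesis using recf_prim[OF assms(1)[unfolded computable_def] *] assms(3)
    unfolding computable_def by simp
qed

lemma computable_Least0:
  assumes "computable (\<lambda>z. f (pfst z) (psnd z))" "\<And>x. \<exists>y. f y x = 0"
  shows "computable (\<lambda>x. LEAST y. f y x = 0)"
  unfolding computable_def
proof (rule recf_least[where f = "\<lambda>y xs. f y (xs ! 0)"])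
  have "recf 2 (\<lambda>ys. prod_encode (ys ! 0, ys ! 1))"
    unfolding prod_encode_def case_prod_conv by (intro recf_add recf_triangle recf_proj) auto
  from recf_comp1[OF assms(1)[unfolded computable_def] this]
  have "recf (Suc 1) (\<lambda>ys. f (ys ! 0) (ys ! 1))" by (simp add: numeral_2_eq_2)
  then show "recf (Suc 1) (\<lambda>ys. f (ys ! 0) (tl ys ! 0))" by (rule recf_cong) (simp add: nth_tl)
qed (use assms(2) in auto)

lemma computable_cong: "computable f \<Longrightarrow> (\<And>x. f x = g x) \<Longrightarrow> computable g"
  by (subgoal_tac "f = g") auto

lemma computable_compose2:
  assumes "computable (\<lambda>z. op (pfst z) (psnd z))" "computable f" "computable g"
  shows "computable (\<lambda>x. op (f x) (g x))"
  using computable_compose[OF assms(1) computable_pair[OF assms(2,3)]] by simp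

lemma computable_mult [comp_intros]:
  "computable f \<Longrightarrow> computable g \<Longrightarrow> computable (\<lambda>x. f x * g x)"
proof (rule computable_compose2[where op = "(*)"])
  have "computable (\<lambda>z. rec_nat 0 (\<lambda>y r. pfst z + r) (psnd z))"
    by (intro comp_intros)
  moreover have "rec_nat 0 (\<lambda>y r. a + r) m = a * m" for a m :: nat by (induction m) auto
  ultimately show "computable (\<lambda>z. pfst z * psnd z)" by simp
qed

lemma computable_power [comp_intros]:
  "computable f \<Longrightarrow> computable g \<Longrightarrow> computable (\<lambda>x. f x ^ g x)"
proof (rule computable_compose2[where op = "(^)"])
  have "computable (\<lambda>z. rec_nat 1 (\<lambda>y r. pfst z * r) (psnd z))"
    by (intro comp_intros)
  moreover have "rec_nat 1 (\<lambda>y r. a * r) m = a ^ m" for a m :: nat by (induction m) auto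
  ultimately show "computable (\<lambda>z. pfst z ^ psnd z)" by simp
qed

lemma computable_If [comp_intros]:
  assumes "decpred P" "computable f" "computable g"
  shows "computable (\<lambda>x. if P x then f x else g x)"
proof -
  have "computable (\<lambda>x. (if P x then 1 else 0) * f x + (1 - (if P x then 1 else 0)) * g x)"
    using assms unfolding decpred_def by (intro comp_intros)
  then show ?thesis by (rule computable_cong) auto
qed

lemma decpred_iff0: "computable f \<Longrightarrow> decpred (\<lambda>x. f x = 0)"
proof -
  assume "computable f"
  then have "computable (\<lambda>x. 1 - f x)" by (intro comp_intros)
  then show ?thesis unfolding decpred_def
    by (rule computable_cong) auto
qed

lemma decpred_not [comp_intros]: "decpred P \<Longrightarrow> decpred (\<lambda>x. \<not> P x)"
proof -
  assume "decpred P"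
  then have "decpred (\<lambda>x. (if P x then 1 else 0) = (0::nat))"
    unfolding decpred_def[of P] by (rule decpred_iff0)
  moreover have "((if P x then 1 else 0) = (0::nat)) = (\<not> P x)" for x by simp
  ultimately show ?thesis by (simp only:)
qed

lemma decpred_le [comp_intros]: "computable f \<Longrightarrow> computable g \<Longrightarrow> decpred (\<lambda>x. f x \<le> g x)"
  using decpred_iff0[OF computable_diff[of f g]] by simp

lemma decpred_conj [comp_intros]: "decpred P \<Longrightarrow> decpred Q \<Longrightarrow> decpred (\<lambda>x. P x \<and> Q x)"
proof -
  assume *: "decpred P" "decpred Q"
  have "computable (\<lambda>x. (if P x then 1 else 0) * (if Q x then 1 else 0))"
    by (intro computable_mult *[unfolded decpred_def])
  then show ?thesis unfolding decpred_def
    by (rule computable_cong) auto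
qed

lemma decpred_disj [comp_intros]: "decpred P \<Longrightarrow> decpred Q \<Longrightarrow> decpred (\<lambda>x. P x \<or> Q x)"
  using decpred_not[OF decpred_conj[OF decpred_not[of P] decpred_not[of Q]]] by simp

lemma decpred_imp [comp_intros]: "decpred P \<Longrightarrow> decpred Q \<Longrightarrow> decpred (\<lambda>x. P x \<longrightarrow> Q x)"
  using decpred_disj[OF decpred_not[of P], of Q] by simp

lemma decpred_less [comp_intros]: "computable f \<Longrightarrow> computable g \<Longrightarrow> decpred (\<lambda>x. f x < g x)"
  using decpred_not[OF decpred_le[of g f]] by (simp add: not_le)

lemma decpred_eq [comp_intros]: "computable f \<Longrightarrow> computable g \<Longrightarrow> decpred (\<lambda>x. f x = g x)"
  using decpred_conj[OF decpred_le[of f g] decpred_le[of g f]] by (simp add: eq_iff)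

lemma decpred_const [comp_intros]: "decpred (\<lambda>x. b)"
  unfolding decpred_def by (cases b) (auto intro: comp_intros)

lemma decpred_compose: "decpred P \<Longrightarrow> computable g \<Longrightarrow> decpred (\<lambda>x. P (g x))"
  unfolding decpred_def by (rule computable_compose)

lemma computable_max [comp_intros]:
  "computable f \<Longrightarrow> computable g \<Longrightarrow> computable (\<lambda>x. max (f x) (g x))"
  unfolding max_def by (intro comp_intros)

lemma computable_Least:
  assumes "decpred (\<lambda>z. P (pfst z) (psnd z))" "\<And>x. \<exists>y. P y x"
  shows "computable (\<lambda>x. LEAST y. P y x)"
proof -
  have "computable (\<lambda>x. LEAST y. (if \<not> P y x then 1 else 0) = (0::nat))"
    using decpred_not[OF assms(1)] assms(2) unfolding decpred_def by (intro computable_Least0) auto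
  moreover have "((if \<not> P y x then 1 else 0) = (0::nat)) = P y x" for y x by simp
  ultimately show ?thesis by (simp only:)
qed

lemma decpred_compose2:
  assumes "decpred (\<lambda>z. P (pfst z) (psnd z))" "computable f" "computable g"
  shows "decpred (\<lambda>x. P (f x) (g x))"
  using decpred_compose[OF assms(1) computable_pair[OF assms(2,3)]] by simp

text \<open>Bounded search by unbounded minimization: \<open>i < b x \<longrightarrow> P i x\<close>
  holds at \<open>i = b x\<close>, so the search always succeeds, and its result is below
  \<open>b x\<close> exactly if there is a witness.\<close>

lemma decpred_bex [comp_intros]:
  assumes "decpred (\<lambda>z. P (pfst z) (psnd z))" "computable b"
  shows "decpred (\<lambda>x. \<exists>i<b x. P i x)"
proof -
  have "decpred (\<lambda>z. pfst z < b (psnd z) \<longrightarrow> P (pfst z) (psnd z))"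
    by (intro comp_intros assms(1) computable_compose[OF assms(2)])
  then have "computable (\<lambda>x. LEAST i. i < b x \<longrightarrow> P i x)"
    by (rule computable_Least) auto
  then have "decpred (\<lambda>x. (LEAST i. i < b x \<longrightarrow> P i x) < b x)"
    using assms(2) by (intro comp_intros)
  moreover have "(LEAST i. i < b x \<longrightarrow> P i x) < b x \<longleftrightarrow> (\<exists>i<b x. P i x)" for x
  proof
    have "(LEAST i. i < b x \<longrightarrow> P i x) < b x \<longrightarrow> P (LEAST i. i < b x \<longrightarrow> P i x) x"
      by (rule LeastI[of "\<lambda>i. i < b x \<longrightarrow> P i x" "b x"]) simp
    then show "(LEAST i. i < b x \<longrightarrow> P i x) < b x \<Longrightarrow> \<exists>i<b x. P i x" by blast
  next
    assume "\<exists>i<b x. P i x"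
    then obtain i where "i < b x" "P i x" by blast
    then show "(LEAST i. i < b x \<longrightarrow> P i x) < b x"
      using Least_le[of "\<lambda>i. i < b x \<longrightarrow> P i x" i] by simp
  qed
  ultimately show ?thesis by simp
qed

lemma decpred_ball [comp_intros]:
  assumes "decpred (\<lambda>z. P (pfst z) (psnd z))" "computable b"
  shows "decpred (\<lambda>x. \<forall>i<b x. P i x)"
  using decpred_not[OF decpred_bex[OF decpred_not[OF assms(1)] assms(2)]] by simp

lemma decidable_if_decpred:
  assumes "decpred P" shows "decidable {x. P x}"
proof -
  obtain g where "recursive 1 g" "\<And>xs. length xs = 1 \<Longrightarrow> g xs = (if P (xs ! 0) then 1 else 0)"
    using assms unfolding decpred_def computable_def recf_def by blast
  then show ?thesis unfolding decidable_def by (intro exI[of _ g]) auto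
qed

section \<open>Lists coded as numbers\<close>

definition lcons :: "nat \<Rightarrow> nat \<Rightarrow> nat" where "lcons x l = Suc (prod_encode (x, l))"
definition lhd :: "nat \<Rightarrow> nat" where "lhd l = pfst (l - 1)"
definition ltl :: "nat \<Rightarrow> nat" where "ltl l = psnd (l - 1)"
definition ldrop :: "nat \<Rightarrow> nat \<Rightarrow> nat" where "ldrop i l = rec_nat l (\<lambda>_ r. ltl r) i"
definition lnth :: "nat \<Rightarrow> nat \<Rightarrow> nat" where "lnth l i = lhd (ldrop i l)"
text \<open>\<open>0\<close> is the code of \<open>[]\<close> alone, so the length is the number of
  tails to take until the code vanishes.\<close>

definition llen :: "nat \<Rightarrow> nat" where "llen l = (LEAST i. ldrop i l = 0)"

lemma lhd_encode [simp]: "lhd (list_encode (x # xs)) = x"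
  and ltl_encode [simp]: "ltl (list_encode (x # xs)) = list_encode xs"
  by (simp_all add: lhd_def ltl_def)

lemma list_encode_eq_0 [simp]: "list_encode xs = 0 \<longleftrightarrow> xs = []"
  by (cases xs) auto

lemma ldrop_encode: "i \<le> length xs \<Longrightarrow> ldrop i (list_encode xs) = list_encode (drop i xs)"
proof (induction i)
  case (Suc i)
  then have "drop i xs = xs ! i # drop (Suc i) xs" by (simp add: Cons_nth_drop_Suc)
  with Suc show ?case by (simp add: ldrop_def del: list_encode.simps)
qed (simp add: ldrop_def)

lemma lnth_encode [simp]: "i < length xs \<Longrightarrow> lnth (list_encode xs) i = xs ! i"
  by (simp add: lnth_def ldrop_encode Cons_nth_drop_Suc[symmetric] del: list_encode.simps)

lemma llen_encode [simp]: "llen (list_encode xs) = length xs"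
  unfolding llen_def
proof (rule Least_equality)
  show "ldrop (length xs) (list_encode xs) = 0" by (simp add: ldrop_encode)
  fix i assume "ldrop i (list_encode xs) = 0"
  then show "length xs \<le> i" using ldrop_encode[of i xs] by (cases "i \<le> length xs") auto
qed

lemma computable_lcons [comp_intros]:
  "computable f \<Longrightarrow> computable g \<Longrightarrow> computable (\<lambda>x. lcons (f x) (g x))"
  unfolding lcons_def by (intro comp_intros)

lemma computable_lhd [comp_intros]: "computable f \<Longrightarrow> computable (\<lambda>x. lhd (f x))"
  unfolding lhd_def by (intro comp_intros)

lemma computable_ltl [comp_intros]: "computable f \<Longrightarrow> computable (\<lambda>x. ltl (f x))"
  unfolding ltl_def by (intro comp_intros)

lemma computable_ldrop [comp_intros]:
  "computable f \<Longrightarrow> computable g \<Longrightarrow> computable (\<lambda>x. ldrop (f x) (g x))"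
  unfolding ldrop_def by (intro comp_intros)

lemma computable_lnth [comp_intros]:
  "computable f \<Longrightarrow> computable g \<Longrightarrow> computable (\<lambda>x. lnth (f x) (g x))"
  unfolding lnth_def by (intro comp_intros)

lemma computable_llen [comp_intros]: "computable f \<Longrightarrow> computable (\<lambda>x. llen (f x))"
proof (rule computable_compose[where f = llen])
  have "\<exists>i. ldrop i l = 0" for l
    using ldrop_encode[of "length (list_decode l)" "list_decode l"] by auto
  then show "computable llen" unfolding llen_def
    by (intro computable_Least comp_intros)
qed

definition lmem :: "nat \<Rightarrow> nat \<Rightarrow> bool" where "lmem x l \<longleftrightarrow> (\<exists>i<llen l. lnth l i = x)"

lemma lmem_encode [simp]: "lmem x (list_encode xs) \<longleftrightarrow> x \<in> set xs"
  by (auto simp: lmem_def in_set_conv_nth)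

lemma decpred_lmem [comp_intros]:
  "computable f \<Longrightarrow> computable g \<Longrightarrow> decpred (\<lambda>x. lmem (f x) (g x))"
proof (rule decpred_compose2)
  show "decpred (\<lambda>z. lmem (pfst z) (psnd z))" unfolding lmem_def by (intro comp_intros)
qed

section \<open>Unboundedness of runs of a stack automaton\<close>

lemma iterate_unbounded_iff:
  fixes x :: "nat \<Rightarrow> 's"
  assumes step: "\<And>n. x (Suc n) = F (x n)" and X: "\<And>n. x n \<in> X" "finite X" "card X \<le> K"
  shows "(\<forall>B. \<exists>n>B. P (x n)) \<longleftrightarrow> (\<exists>n. K \<le> n \<and> n \<le> 2 * K \<and> P (x n))"
proof -
  have "\<not> inj_on x {..K}"
  proof
    assume "inj_on x {..K}"
    then have "card {..K} \<le> card X" using X by (intro card_inj_on_le[of x]) auto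
    then show False using X(3) by simp
  qed
  then obtain i j where ij: "i < j" "j \<le> K" "x i = x j"
    unfolding inj_on_def by (metis atMost_iff linorder_neqE_nat)
  have per: "x (n + (j - i)) = x n" if "i \<le> n" for n
    using that
  proof (induction n rule: dec_induct)
    case (step n)
    then show ?case using assms(1)[of n] assms(1)[of "n + (j - i)"] by simp
  qed (use ij in simp)
  have per': "x (n + k * (j - i)) = x n" if "i \<le> n" for n k
  proof (induction k)
    case (Suc k)
    then show ?case using per[of "n + k * (j - i)"] that by (simp add: ac_simps)
  qed simp
  show ?thesis
  proof
    assume "\<forall>B. \<exists>n>B. P (x n)"
    then obtain n where "n \<ge> K" "P (x n)" by (meson less_imp_le)
    then show "\<exists>n. K \<le> n \<and> n \<le> 2 * K \<and> P (x n)"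
    proof (induction n rule: less_induct)
      case (less n)
      show ?case
      proof (cases "n \<le> 2 * K")
        case False
        \<comment> \<open>Here \<open>n > 2 * K\<close> and the period is at most \<open>K\<close>,
          so \<open>n - (j - i)\<close> is still at least \<open>K\<close> and lies in the periodic
          part.\<close>
        then have "x (n - (j - i)) = x n" using per[of "n - (j - i)"] ij by simp
        then show ?thesis using less.IH[of "n - (j - i)"] less.prems False ij by simp
      qed (use less in blast)
    qed
  next
    assume "\<exists>n. K \<le> n \<and> n \<le> 2 * K \<and> P (x n)"
    then obtain n where n: "K \<le> n" "P (x n)" by blast
    show "\<forall>B. \<exists>n>B. P (x n)"
    proof
      fix B
      obtain e where "j - i = Suc e" using ij(1) by (metis Suc_diff_Suc)
      then have "B < n + Suc B * (j - i)" by simp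
      moreover have "P (x (n + Suc B * (j - i)))" using per'[of n "Suc B"] n ij by simp
      ultimately show "\<exists>n>B. P (x n)" by blast
    qed
  qed
qed

text \<open>Configurations without the input. The part of the stack up to the head is stored with the
  scanned symbol first.\<close>

type_synonym ('q, 'g) iconfig = "'q \<times> 'g stksym list \<times> 'g stksym list"

fun apply_instr ::
  "'g instr \<Rightarrow> 'g stksym list \<Rightarrow> 'g stksym list \<Rightarrow> ('g stksym list \<times> 'g stksym list) option" where
  "apply_instr Stay a b = (if b = [Top] then Some (a, b) else None)"
| "apply_instr (Push y) a b = (if b = [Top] then Some (Sym y # a, b) else None)"
| "apply_instr Pop a b = (if b = [Top] \<and> hd a \<noteq> Bot then Some (tl a, b) else None)"
| "apply_instr MoveDown a b = (if hd a \<noteq> Bot then Some (tl a, hd a # b) else None)"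
| "apply_instr MoveNone a b = Some (a, b)"
| "apply_instr MoveUp a b = (if b = [] then None else Some (hd b # a, tl b))"

fun iconfig_size :: "('q, 'g) iconfig \<Rightarrow> nat" where
  "iconfig_size (q, a, b) = length a + length b - 2"

section \<open>Input-free runs, summaries and levels\<close>

locale sa_with_targets =
  fixes M :: "('q, 'a, 'g) sa" and Fin :: "'q set"
  assumes sa: "stack_automaton M"
begin

abbreviation "Q \<equiv> states M"

definition moves :: "'g stksym \<Rightarrow> 'g instr \<Rightarrow> 'q rel" where
  "moves x i = {(q, p). \<exists>l. ((q, l, x), (p, i)) \<in> transitions M}"

fun istep :: "('q, 'g) iconfig \<Rightarrow> ('q, 'g) iconfig \<Rightarrow> bool" where
  "istep (q, a, b) (p, a', b') \<longleftrightarrow>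
     a \<noteq> [] \<and> (\<exists>i. (q, p) \<in> moves (hd a) i \<and> apply_instr i a b = Some (a', b'))"

text \<open>The number is the largest stack size so far, which turns the maximum over a run into a
  coordinate of the node reached. Runs start with \<open>0\<close> because the initial stack holds
  only the markers.\<close>

fun tstep :: "nat \<times> ('q, 'g) iconfig \<Rightarrow> nat \<times> ('q, 'g) iconfig \<Rightarrow> bool" where
  "tstep (m, c) (m', c') \<longleftrightarrow> istep c c' \<and> m' = max m (iconfig_size c')"

abbreviation nreach :: "nat \<Rightarrow> ('q, 'g) iconfig \<Rightarrow> bool" where
  "nreach m c \<equiv> tstep\<^sup>*\<^sup>* (0, (init M, [Bot], [Top])) (m, c)"

abbreviation "none x \<equiv> moves x MoveNone"
abbreviation "up x \<equiv> moves x MoveUp"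
definition "down x = (if x = Bot then {} else moves x MoveDown)"
definition "pops x = (if x = Bot then {} else moves x Pop)"

lemma moves_states: "moves x i \<subseteq> Q \<times> Q"
  using sa unfolding stack_automaton_def moves_def by blast

lemma down_states: "down x \<subseteq> Q \<times> Q" and pops_states: "pops x \<subseteq> Q \<times> Q"
  using moves_states by (auto simp: down_def pops_def)

lemma moves_Push: "(q, p) \<in> moves x (Push y) \<Longrightarrow> y \<in> stack0 M"
  using sa unfolding stack_automaton_def moves_def instrs_def by blast

text \<open>A summary \<open>(x, S, A)\<close> of a stack content \<open>w\<close> (without \<^const>\<open>Top\<close>, topmost symbol first)
  consists of its topmost symbol \<open>x\<close>, the pairs \<open>(p, q)\<close> such that reading moves inside \<open>w\<close> lead
  from \<open>p\<close> to \<open>q\<close> with the head on \<open>x\<close> at both ends, and the states from which such moves, starting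
  with the head on \<open>x\<close>, reach a state of \<open>Fin\<close>.\<close>

type_synonym ('s, 'h) summary = "'h stksym \<times> 's rel \<times> 's set"

text \<open>Decomposition by the visits to the new top symbol \<open>y\<close>: between two of them
  the head stays, or steps down to \<open>x\<close>, sweeps the old content and steps up again. The
  intersection with \<open>Q \<times> Q\<close> removes reflexive pairs of elements outside
  \<open>Q\<close>, so that only finitely many summaries occur. In the last component the final
  descent need not be followed by a return.\<close>

definition extend :: "('q, 'g) summary \<Rightarrow> 'g stksym \<Rightarrow> ('q, 'g) summary" where
  "extend t y = (case t of (x, S, A) \<Rightarrow>
     let S' = (none y \<union> down y O S O up x)\<^sup>* \<inter> Q \<times> Q
     in (y, S', {p. \<exists>p'. (p, p') \<in> S' \<and> (p' \<in> Fin \<or> (\<exists>p''\<in>A. (p', p'') \<in> down y))}))"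

text \<open>The base has empty relations, so nothing can be read below the bottom of the
  stack.\<close>

fun summary_of :: "'g stksym list \<Rightarrow> ('q, 'g) summary" where
  "summary_of [] = (Bot, {}, {})"
| "summary_of (y # w) = extend (summary_of w) y"

definition symb :: "('q, 'g) summary \<Rightarrow> 'g stksym" where "symb t = fst t"
definition sweep :: "('q, 'g) summary \<Rightarrow> 'q rel" where "sweep t = fst (snd t)"
definition hits :: "('q, 'g) summary \<Rightarrow> 'q set" where "hits t = snd (snd t)"

lemma symb_extend [simp]: "symb (extend t y) = y"
  and sweep_extend: "sweep (extend t y) = (none y \<union> down y O sweep t O up (symb t))\<^sup>* \<inter> Q \<times> Q"
  and hits_extend: "hits (extend t y) = {p. \<exists>p'. (p, p') \<in> sweep (extend t y) \<and>
    (p' \<in> Fin \<or> (\<exists>p''\<in>hits t. (p', p'') \<in> down y))}"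
  by (auto simp: extend_def symb_def sweep_def hits_def Let_def split: prod.splits)

lemma sweep_Nil [simp]: "sweep (Bot, {}, {}) = {}" and hits_Nil [simp]: "hits (Bot, {}, {}) = {}"
  by (simp_all add: sweep_def hits_def)

lemma symb_summary_of [simp]: "w \<noteq> [] \<Longrightarrow> symb (summary_of w) = hd w"
  by (cases w) auto

lemma sweep_refl: "w \<noteq> [] \<Longrightarrow> q \<in> Q \<Longrightarrow> (q, q) \<in> sweep (summary_of w)"
  by (cases w) (auto simp: sweep_extend)

lemma sweep_states: "sweep (summary_of w) \<subseteq> Q \<times> Q"
  by (cases w) (auto simp: sweep_extend)

definition topx :: "'g stksym \<Rightarrow> 'q rel" where
  "topx x = up x O (none Top)\<^sup>*"

text \<open>The ways back to the top of an unchanged content without a push: an excursion into it, a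
  visit to the marker \<open>Top\<close>, or the write move \<open>Stay\<close>. The latter is kept
  out of \<open>sweep\<close> because it is legal only when the scanned symbol is the topmost
  one.\<close>

definition local :: "('q, 'g) summary \<Rightarrow> 'q rel" where
  "local t = sweep t \<union> topx (symb t) O down Top \<union> moves (symb t) Stay"

definition accepts :: "('q, 'g) summary \<Rightarrow> 'q set" where
  "accepts t = hits t \<union> {p. \<exists>p'\<in>Fin. (p, p') \<in> topx (symb t)}"

text \<open>\<open>(t, p, f, r)\<close> in \<open>level d\<close>: from state \<open>p\<close>, with the head at the top of a stack content summarized
  by \<open>t\<close>, there is a run that grows the stack by at most \<open>d\<close> symbols, by exactly \<open>d\<close> if \<open>f\<close>, and
  ends by popping the topmost symbol of that content in state \<open>q\<close> if \<open>r = Some q\<close>, and in a state of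
  \<open>Fin\<close> if \<open>r = None\<close>.\<close>

type_synonym ('s, 'h) behaviour = "(('s, 'h) summary \<times> 's \<times> bool \<times> 's option) set"

text \<open>A push with everything up to its matching pop counts as one step, looked up in
  \<open>g\<close>, the behaviours one symbol higher. The flag only accumulates: it records whether
  the full size has been reached so far.\<close>

definition lstep :: "('q, 'g) behaviour \<Rightarrow> ('q, 'g) summary \<Rightarrow> ('q \<times> bool) rel" where
  "lstep g t = {((p, f), (p', f')). (p, p') \<in> local t \<and> f' = f \<or>
     (\<exists>y p1 f1. (p, p1) \<in> moves (symb t) (Push y) \<and> (extend t (Sym y), p1, f1, Some p') \<in> g \<and>
       f' = (f \<or> f1))}"

definition lacc :: "('q, 'g) behaviour \<Rightarrow> ('q, 'g) summary \<Rightarrow> 'q \<Rightarrow> bool \<Rightarrow> bool" where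
  "lacc g t p f \<longleftrightarrow> p \<in> accepts t \<and> \<not> f \<or>
     (\<exists>y p1. (p, p1) \<in> moves (symb t) (Push y) \<and> (extend t (Sym y), p1, f, None) \<in> g)"

definition summaries :: "('q, 'g) summary set" where
  "summaries = insert Bot (Sym ` stack0 M) \<times> Pow (Q \<times> Q) \<times> Pow Q"

definition universe :: "('q, 'g) behaviour" where
  "universe = summaries \<times> Q \<times> UNIV \<times> insert None (Some ` Q)"

text \<open>\<open>fl\<close> is the flag at the start. The levels set it only when no room is left:
  the full size is then attained at once, and \<open>g = {}\<close> allows no push. The restriction
  to \<open>universe\<close> keeps the iteration in a finite set.\<close>

definition next_level :: "bool \<Rightarrow> ('q, 'g) behaviour \<Rightarrow> ('q, 'g) behaviour" where
  "next_level fl g = {(t, p, f, r). (t, p, f, r) \<in> universe \<and>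
     (\<exists>p' f'. ((p, fl), (p', f')) \<in> (lstep g t)\<^sup>* \<and>
       (case r of None \<Rightarrow> \<exists>f''. lacc g t p' f'' \<and> f = (f' \<or> f'')
        | Some q \<Rightarrow> (p', q) \<in> pops (symb t) \<and> f = f'))}"

fun level :: "nat \<Rightarrow> ('q, 'g) behaviour" where
  "level 0 = next_level True {}"
| "level (Suc d) = next_level False (level d)"

text \<open>\<open>d\<close> is the room before a push, and the value describes what can happen
  after it; without room there is nothing. This joins the two equations of \<open>level\<close> into
  \<open>level_eq\<close>.\<close>

definition below :: "nat \<Rightarrow> ('q, 'g) behaviour" where
  "below d = (case d of 0 \<Rightarrow> {} | Suc e \<Rightarrow> level e)"

lemma level_eq: "level d = next_level (d = 0) (below d)"
  by (cases d) (auto simp: below_def)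

lemma level_universe: "level d \<subseteq> universe"
  by (cases d) (auto simp: next_level_def)

section \<open>Soundness: every entry of a level comes from a run\<close>

lemma tstep_none:
  assumes "(q, p) \<in> none x" "length w + length b - 1 \<le> m"
  shows "tstep (m, (q, x # w, b)) (m, (p, x # w, b))"
  using assms by (auto intro!: exI[of _ MoveNone])

lemma tstep_down:
  assumes "(q, p) \<in> down x" "length w + length b - 1 \<le> m"
  shows "tstep (m, (q, x # w, b)) (m, (p, w, x # b))"
  using assms by (auto simp: down_def intro!: exI[of _ MoveDown] split: if_splits)

lemma tstep_up:
  assumes "(q, p) \<in> up x" "length w + length b \<le> m"
  shows "tstep (m, (q, x # w, y # b)) (m, (p, y # x # w, b))"
  using assms by (auto intro!: exI[of _ MoveUp])

text \<open>The premise on \<open>m\<close> says that the current size is within the peak. Reading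
  moves keep the size, so the peak stays \<open>m\<close> throughout.\<close>

lemma sweep_sound:
  assumes "(p, q) \<in> sweep (summary_of w)" "length w + length b - 2 \<le> m"
  shows "tstep\<^sup>*\<^sup>* (m, (p, w, b)) (m, (q, w, b))"
  using assms
proof (induction w arbitrary: p q b)
  case (Cons y w)
  from Cons.prems(1) have "(p, q) \<in> (none y \<union> down y O sweep (summary_of w) O up (symb (summary_of w)))\<^sup>*"
    by (simp add: sweep_extend)
  then show ?case
  proof (induction rule: rtrancl_induct)
    case (step q r)
    from step.hyps(2) have "tstep\<^sup>*\<^sup>* (m, (q, y # w, b)) (m, (r, y # w, b))"
    proof
      assume "(q, r) \<in> none y"
      then show ?thesis using Cons.prems(2) by (intro r_into_rtranclp tstep_none) auto
    next
      assume "(q, r) \<in> down y O sweep (summary_of w) O up (symb (summary_of w))"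
      then obtain q1 q2 where q: "(q, q1) \<in> down y" "(q1, q2) \<in> sweep (summary_of w)"
        "(q2, r) \<in> up (symb (summary_of w))" by blast
      then obtain x v where w: "w = x # v" by (cases w) auto
      have "tstep (m, (q, y # w, b)) (m, (q1, w, y # b))"
        by (rule tstep_down) (use q Cons.prems(2) in auto)
      moreover have "tstep\<^sup>*\<^sup>* (m, (q1, w, y # b)) (m, (q2, w, y # b))"
        by (rule Cons.IH) (use q Cons.prems(2) in auto)
      moreover have "tstep (m, (q2, w, y # b)) (m, (r, y # w, b))"
        unfolding w by (rule tstep_up) (use q Cons.prems(2) w in auto)
      ultimately show ?thesis by (meson converse_rtranclp_into_rtranclp rtranclp.rtrancl_into_rtrancl)
    qed
    with step.IH show ?case by (rule rtranclp_trans)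
  qed simp
qed simp

lemma hits_sound:
  assumes "p \<in> hits (summary_of w)" "length w + length b - 2 \<le> m"
  shows "\<exists>c. tstep\<^sup>*\<^sup>* (m, (p, w, b)) (m, c) \<and> fst c \<in> Fin"
  using assms
proof (induction w arbitrary: p b)
  case (Cons y w)
  then obtain p' where p': "(p, p') \<in> sweep (summary_of (y # w))"
    "p' \<in> Fin \<or> (\<exists>p''\<in>hits (summary_of w). (p', p'') \<in> down y)"
    by (auto simp: hits_extend)
  have 1: "tstep\<^sup>*\<^sup>* (m, (p, y # w, b)) (m, (p', y # w, b))"
    by (rule sweep_sound) fact+
  from p'(2) show ?case
  proof
    assume "p' \<in> Fin"
    then show ?thesis using 1 by force
  next
    assume "\<exists>p''\<in>hits (summary_of w). (p', p'') \<in> down y"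
    then obtain p'' where p'': "p'' \<in> hits (summary_of w)" "(p', p'') \<in> down y" by blast
    have "tstep (m, (p', y # w, b)) (m, (p'', w, y # b))"
      by (rule tstep_down) (use p'' Cons.prems(2) in auto)
    moreover obtain c where "tstep\<^sup>*\<^sup>* (m, (p'', w, y # b)) (m, c)" "fst c \<in> Fin"
      using Cons.IH[OF p''(1), of "y # b"] Cons.prems(2) by auto
    ultimately show ?thesis using 1
      by (meson converse_rtranclp_into_rtranclp rtranclp_trans)
  qed
qed simp

lemma topx_sound:
  assumes "(p, q) \<in> topx (hd w)" "w \<noteq> []" "length w - 1 \<le> m"
  shows "tstep\<^sup>*\<^sup>* (m, (p, w, [Top])) (m, (q, Top # w, []))"
proof -
  obtain x v where w: "w = x # v" using assms(2) by (cases w) auto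
  obtain p1 where p1: "(p, p1) \<in> up x" "(p1, q) \<in> (none Top)\<^sup>*"
    using assms(1) w by (auto simp: topx_def)
  have "tstep (m, (p, w, [Top])) (m, (p1, Top # w, []))"
    unfolding w by (rule tstep_up) (use p1 assms w in auto)
  moreover have "tstep\<^sup>*\<^sup>* (m, (p1, Top # w, [])) (m, (q, Top # w, []))"
    using p1(2)
  proof (induction rule: rtrancl_induct)
    case (step q r)
    have "tstep (m, (q, Top # w, [])) (m, (r, Top # w, []))"
      by (rule tstep_none) (use step assms in auto)
    with step.IH show ?case by (meson rtranclp.rtrancl_into_rtrancl)
  qed simp
  ultimately show ?thesis by (meson converse_rtranclp_into_rtranclp)
qed

lemma local_sound:
  assumes "(p, q) \<in> local (summary_of w)" "w \<noteq> []" "length w - 1 \<le> m"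
  shows "tstep\<^sup>*\<^sup>* (m, (p, w, [Top])) (m, (q, w, [Top]))"
proof -
  consider "(p, q) \<in> sweep (summary_of w)" | "(p, q) \<in> topx (hd w) O down Top"
    | "(p, q) \<in> moves (hd w) Stay"
    using assms(1,2) by (auto simp: local_def)
  then show ?thesis
  proof cases
    case 1
    then show ?thesis using assms by (intro sweep_sound) auto
  next
    case 2
    then obtain r where r: "(p, r) \<in> topx (hd w)" "(r, q) \<in> down Top" by blast
    have "tstep (m, (r, Top # w, [])) (m, (q, w, [Top]))"
      by (rule tstep_down) (use r assms in auto)
    then show ?thesis using topx_sound[OF r(1) assms(2,3)] by (meson rtranclp.rtrancl_into_rtrancl)
  next
    case 3
    then have "tstep (m, (p, w, [Top])) (m, (q, w, [Top]))"
      using assms by (auto intro!: exI[of _ Stay])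
    then show ?thesis by blast
  qed
qed

lemma accepts_sound:
  assumes "p \<in> accepts (summary_of w)" "w \<noteq> []" "length w - 1 \<le> m"
  shows "\<exists>c. tstep\<^sup>*\<^sup>* (m, (p, w, [Top])) (m, c) \<and> fst c \<in> Fin"
proof -
  consider "p \<in> hits (summary_of w)" | q where "(p, q) \<in> topx (hd w)" "q \<in> Fin"
    using assms(1,2) by (auto simp: accepts_def)
  then show ?thesis
  proof cases
    case 1
    then show ?thesis using assms by (intro hits_sound) auto
  next
    case 2
    then show ?thesis using topx_sound[OF 2(1) assms(2,3)] by force
  qed
qed

text \<open>The initial peak \<open>m\<close> is arbitrary because the entry is used in the middle
  of longer runs. The flag gives an implication only: without it, the final peak may still be
  \<open>N\<close> because \<open>m\<close> already was.\<close>

definition realized :: "nat \<Rightarrow> ('q, 'g) behaviour \<Rightarrow> 'g stksym list \<Rightarrow> bool" where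
  "realized N g w \<longleftrightarrow> (\<forall>p f r m. (summary_of w, p, f, r) \<in> g \<longrightarrow> length w - 1 \<le> m \<longrightarrow> m \<le> N \<longrightarrow>
     (\<exists>m' c. tstep\<^sup>*\<^sup>* (m, (p, w, [Top])) (m', c) \<and> m \<le> m' \<and> m' \<le> N \<and> (f \<longrightarrow> m' = N) \<and>
       (case r of None \<Rightarrow> fst c \<in> Fin | Some q \<Rightarrow> c = (q, tl w, [Top]))))"

lemma realizedD:
  assumes "realized N g w" "(summary_of w, p, f, r) \<in> g" "length w - 1 \<le> m" "m \<le> N"
  obtains m' c where "tstep\<^sup>*\<^sup>* (m, (p, w, [Top])) (m', c)" "m \<le> m'" "m' \<le> N" "f \<longrightarrow> m' = N"
    "case r of None \<Rightarrow> fst c \<in> Fin | Some q \<Rightarrow> c = (q, tl w, [Top])"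
  using assms unfolding realized_def by blast

text \<open>\<open>w\<close> includes the marker \<open>Bot\<close>, so \<open>length w\<close> is
  the stack size after the push.\<close>

lemma push_sound:
  assumes "(p, p1) \<in> moves (hd w) (Push y)" "w \<noteq> []"
  shows "tstep (m, (p, w, [Top])) (max m (length w), (p1, Sym y # w, [Top]))"
  using assms by (auto intro!: exI[of _ "Push y"])

text \<open>Each \<open>lstep\<close> of a path is expanded into an actual run, a push-pop shortcut
  by the realizability of \<open>g\<close> above \<open>w\<close>. The premise on nonempty
  \<open>g\<close> rules out pushes beyond size \<open>N\<close>, and a start flag
  \<open>True\<close> is justified because the current size is then \<open>N\<close>.\<close>

lemma next_level_realized:
  assumes g: "\<And>y. realized N g (Sym y # w)" "g \<noteq> {} \<Longrightarrow> length w \<le> N"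
    and w: "w \<noteq> []" "length w - 1 \<le> N" "fl \<Longrightarrow> length w - 1 = N"
  shows "realized N (next_level fl g) w"
  unfolding realized_def
proof (intro allI impI)
  fix p f r m
  assume mem: "(summary_of w, p, f, r) \<in> next_level fl g" and m: "length w - 1 \<le> m" "m \<le> N"
  have run: "\<exists>m'. tstep\<^sup>*\<^sup>* (m, (p, w, [Top])) (m', (p', w, [Top])) \<and> m \<le> m' \<and> m' \<le> N \<and> (f' \<longrightarrow> m' = N)"
    if "((p, fl), (p', f')) \<in> (lstep g (summary_of w))\<^sup>*" for p' f'
    using that
  proof (induction rule: rtrancl_induct2)
    case refl
    then show ?case using m w by (intro exI[of _ m]) auto
  next
    case (step p' f' p'' f'')
    then obtain m' where m': "tstep\<^sup>*\<^sup>* (m, (p, w, [Top])) (m', (p', w, [Top]))" "m \<le> m'" "m' \<le> N"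
      "f' \<longrightarrow> m' = N" by blast
    consider "(p', p'') \<in> local (summary_of w)" "f'' = f'"
      | y p1 f1 where "(p', p1) \<in> moves (hd w) (Push y)" "(summary_of (Sym y # w), p1, f1, Some p'') \<in> g"
         "f'' = (f' \<or> f1)"
      using step.hyps(2) w(1) by (auto simp: lstep_def)
    then show ?case
    proof cases
      case 1
      then have "tstep\<^sup>*\<^sup>* (m', (p', w, [Top])) (m', (p'', w, [Top]))"
        using local_sound[OF 1(1) w(1), of m'] m m' by linarith
      with m'(1) have "tstep\<^sup>*\<^sup>* (m, (p, w, [Top])) (m', (p'', w, [Top]))" by (rule rtranclp_trans)
      then show ?thesis using m' 1(2) by blast
    next
      case 2
      have N: "length w \<le> N" using g(2) 2(2) by blast
      obtain m'' where c: "tstep\<^sup>*\<^sup>* (max m' (length w), (p1, Sym y # w, [Top])) (m'', (p'', w, [Top]))"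
        "max m' (length w) \<le> m''" "m'' \<le> N" "f1 \<longrightarrow> m'' = N"
        by (rule realizedD[OF g(1) 2(2), of "max m' (length w)"]) (use N m'(3) in auto)
      have "tstep\<^sup>*\<^sup>* (m, (p, w, [Top])) (m'', (p'', w, [Top]))"
        using m'(1) push_sound[OF 2(1) w(1), of m'] c(1)
        by (metis (no_types, lifting) converse_rtranclp_into_rtranclp rtranclp_trans)
      then show ?thesis using m'(2-4) c(2-4) 2(3) by (intro exI[of _ m'']) auto
    qed
  qed
  obtain p' f' where p': "((p, fl), (p', f')) \<in> (lstep g (summary_of w))\<^sup>*"
    and out: "case r of None \<Rightarrow> \<exists>f''. lacc g (summary_of w) p' f'' \<and> f = (f' \<or> f'')
        | Some q \<Rightarrow> (p', q) \<in> pops (symb (summary_of w)) \<and> f = f'"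
    using mem by (auto simp: next_level_def)
  obtain m' where m': "tstep\<^sup>*\<^sup>* (m, (p, w, [Top])) (m', (p', w, [Top]))" "m \<le> m'" "m' \<le> N"
      "f' \<longrightarrow> m' = N" using run[OF p'] by blast
  show "\<exists>m' c. tstep\<^sup>*\<^sup>* (m, (p, w, [Top])) (m', c) \<and> m \<le> m' \<and> m' \<le> N \<and> (f \<longrightarrow> m' = N) \<and>
       (case r of None \<Rightarrow> fst c \<in> Fin | Some q \<Rightarrow> c = (q, tl w, [Top]))"
  proof (cases r)
    case (Some q)
    then have q: "(p', q) \<in> pops (hd w)" "f = f'" using out w(1) by auto
    then have "tstep (m', (p', w, [Top])) (m', (q, tl w, [Top]))"
      using w(1) m m' by (cases w) (auto simp: pops_def intro!: exI[of _ Pop] split: if_splits)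
    then have "tstep\<^sup>*\<^sup>* (m, (p, w, [Top])) (m', (q, tl w, [Top]))"
      using m'(1) by (meson rtranclp.rtrancl_into_rtrancl)
    then show ?thesis using m'(2-4) Some q(2) by auto
  next
    case None
    then obtain f'' where f'': "lacc g (summary_of w) p' f''" "f = (f' \<or> f'')" using out by auto
    from f''(1) consider "p' \<in> accepts (summary_of w)" "\<not> f''"
      | y p1 where "(p', p1) \<in> moves (hd w) (Push y)" "(summary_of (Sym y # w), p1, f'', None) \<in> g"
      using w(1) by (auto simp: lacc_def)
    then show ?thesis
    proof cases
      case 1
      then obtain c where "tstep\<^sup>*\<^sup>* (m', (p', w, [Top])) (m', c)" "fst c \<in> Fin"
        using accepts_sound[OF 1(1) w(1), of m'] m m' by auto
      then have "tstep\<^sup>*\<^sup>* (m, (p, w, [Top])) (m', c)" using m'(1) by (meson rtranclp_trans)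
      then show ?thesis using \<open>fst c \<in> Fin\<close> m'(2-4) f''(2) 1(2) None
        by (intro exI[of _ m'] exI[of _ c]) auto
    next
      case 2
      have N: "length w \<le> N" using g(2) 2(2) by blast
      obtain m'' c where c: "tstep\<^sup>*\<^sup>* (max m' (length w), (p1, Sym y # w, [Top])) (m'', c)"
        "max m' (length w) \<le> m''" "m'' \<le> N" "f'' \<longrightarrow> m'' = N" "fst c \<in> Fin"
        by (rule realizedD[OF g(1) 2(2), of "max m' (length w)"]) (use N m'(3) in \<open>simp_all\<close>)
      have "tstep\<^sup>*\<^sup>* (m, (p, w, [Top])) (m'', c)"
        using m'(1) push_sound[OF 2(1) w(1), of m'] c(1)
        by (metis (no_types, lifting) converse_rtranclp_into_rtranclp rtranclp_trans)
      then show ?thesis using m'(2-4) c(2-5) f''(2) None by (intro exI[of _ m''] exI[of _ c]) auto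
    qed
  qed
qed

lemma level_realized: "w \<noteq> [] \<Longrightarrow> length w - 1 + d = N \<Longrightarrow> realized N (level d) w"
proof (induction d arbitrary: w)
  case 0
  have "realized N {} v" for v by (simp add: realized_def)
  then show ?case using 0 by (simp only: level.simps) (rule next_level_realized, auto)
next
  case (Suc d)
  have "realized N (level d) (Sym y # w)" for y
    using Suc.prems by (intro Suc.IH) (cases w; simp)+
  then show ?case using Suc.prems
    by (simp only: level.simps) (rule next_level_realized, cases w, auto)
qed

section \<open>Completeness: pushes and pops of a run are captured by the levels\<close>

context
  fixes N :: nat
begin

text \<open>\<open>length w - 1\<close> is the current size, as \<open>Bot\<close> is not counted;
  the argument of \<open>below\<close> is the room that remains.\<close>

abbreviation behaviour_above :: "'g stksym list \<Rightarrow> ('q, 'g) behaviour" where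
  "behaviour_above w \<equiv> below (N - (length w - 1))"

text \<open>The invariant of a run of stack size at most \<open>N\<close>: when it is in state \<open>p\<close> at the top of \<open>w\<close>, its
  past splits into the pushes that created the symbols of \<open>w\<close>, with local steps in between; \<open>f\<close>
  tells whether the size \<open>N\<close> has been reached.\<close>

inductive chain :: "'g stksym list \<Rightarrow> 'q \<Rightarrow> bool \<Rightarrow> bool" where
  base: "((init M, N = 0), (p, f)) \<in> (lstep (behaviour_above [Bot]) (summary_of [Bot]))\<^sup>* \<Longrightarrow>
    chain [Bot] p f"
| push: "chain w p f \<Longrightarrow> (p, p1) \<in> moves (hd w) (Push y) \<Longrightarrow> length w \<le> N \<Longrightarrow>
    ((p1, length w = N), (p2, f2)) \<in>
      (lstep (behaviour_above (Sym y # w)) (summary_of (Sym y # w)))\<^sup>* \<Longrightarrow>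
    chain (Sym y # w) p2 (f \<or> f2)"

lemma extend_summaries:
  "y \<in> insert Bot (Sym ` stack0 M) \<Longrightarrow> extend t y \<in> summaries"
  by (auto simp: summaries_def extend_def Let_def split: prod.splits)

lemma below_states: "(t, p, f, Some q) \<in> below d \<Longrightarrow> q \<in> Q"
  using level_universe by (auto simp: below_def universe_def split: nat.splits)

lemma topx_states: "topx x \<subseteq> Q \<times> Q"
proof -
  have "(p, q) \<in> (none Top)\<^sup>* \<Longrightarrow> p \<in> Q \<Longrightarrow> q \<in> Q" for p q
    by (induction rule: rtrancl_induct) (use moves_states in auto)
  then show ?thesis unfolding topx_def using moves_states by blast
qed

lemma local_states: "(p, q) \<in> local (summary_of w) \<Longrightarrow> q \<in> Q"
  unfolding local_def using sweep_states moves_states down_states topx_states by blast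

lemma lstep_states:
  "((p, f), (p', f')) \<in> (lstep (below d) (summary_of w))\<^sup>* \<Longrightarrow> p \<in> Q \<Longrightarrow> p' \<in> Q"
  by (induction rule: rtrancl_induct2) (auto simp: lstep_def dest: local_states below_states)

lemma chain_props:
  "chain w p f \<Longrightarrow> w \<noteq> [] \<and> last w = Bot \<and> Top \<notin> set w \<and> length w - 1 \<le> N \<and> p \<in> Q \<and>
    summary_of w \<in> summaries"
proof (induction rule: chain.induct)
  case (base p f)
  have "init M \<in> Q" using sa by (simp add: stack_automaton_def)
  then show ?case using lstep_states[OF base] extend_summaries[of Bot] by simp
next
  case (push w p f p1 y p2 f2)
  have "p1 \<in> Q" using push.hyps(2) moves_states by blast
  then show ?case using push lstep_states[OF push.hyps(4)] extend_summaries[of "Sym y"] moves_Push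
    by auto
qed

lemma chain_local: "chain w p f \<Longrightarrow> (p, q) \<in> local (summary_of w) \<Longrightarrow> chain w q f"
proof (induction rule: chain.cases)
  case (base p f)
  have "((p, f), (q, f)) \<in> lstep (behaviour_above [Bot]) (summary_of [Bot])"
    using base by (auto simp: lstep_def)
  then show ?case using base chain.base by (meson rtrancl_into_rtrancl)
next
  case (push w p f p1 y p2 f2)
  have "((p2, f2), (q, f2)) \<in> lstep (behaviour_above (Sym y # w)) (summary_of (Sym y # w))"
    using push by (auto simp: lstep_def)
  then show ?case using push chain.push by (meson rtrancl_into_rtrancl)
qed

lemma chain_return:
  "chain w p f \<Longrightarrow> (p, p1) \<in> moves (hd w) (Push y) \<Longrightarrow>
    (summary_of (Sym y # w), p1, f1, Some q) \<in> behaviour_above w \<Longrightarrow> chain w q (f \<or> f1)"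
proof (induction rule: chain.cases)
  case (base p f)
  have "((p, f), (q, f \<or> f1)) \<in> lstep (behaviour_above [Bot]) (summary_of [Bot])"
    using base by (auto simp: lstep_def)
  then show ?case using base chain.base by (meson rtrancl_into_rtrancl)
next
  case (push w p f p1 y p2 f2)
  have "((p2, f2), (q, f2 \<or> f1)) \<in> lstep (behaviour_above (Sym y # w)) (summary_of (Sym y # w))"
    using push by (auto simp: lstep_def)
  then have "chain (Sym y # w) q (f \<or> (f2 \<or> f1))"
    using push chain.push by (meson rtrancl_into_rtrancl)
  then show ?case using push by (simp add: disj_assoc)
qed

text \<open>The flag and the behaviours match those of the rule \<open>push\<close> of
  \<open>chain\<close>, so the topmost segment of a chain is literally a path over which
  \<open>next_level\<close> quantifies.\<close>

lemma behaviour_above_level: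
  assumes "w \<noteq> []" "length w \<le> N"
  shows "behaviour_above w = next_level (length w = N) (behaviour_above (Sym y # w))"
proof -
  have "N - (length w - 1) = Suc (N - length w)" using assms by (cases w) auto
  then have "behaviour_above w = level (N - length w)" by (simp add: below_def)
  also have "\<dots> = next_level (length w = N) (behaviour_above (Sym y # w))"
    unfolding level_eq[of "N - length w"] using assms(2) by (simp add: eq_commute[of "length w" N])
  finally show ?thesis .
qed

text \<open>The pop completes the topmost segment to an entry of \<open>behaviour_above w\<close>,
  so the whole episode since the push becomes a single \<open>lstep\<close> in the segment of
  \<open>w\<close>.\<close>

lemma chain_pop:
  assumes "chain (Sym y # w) p f" "(p, q) \<in> pops (Sym y)"
  shows "chain w q f"
  using assms(1)
proof cases
  case (push p0 f0 p1 f2)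
  have w: "w \<noteq> []" and s: "summary_of (Sym y # w) \<in> summaries"
    using chain_props[OF push(2)] chain_props[OF assms(1)] by auto
  have "p1 \<in> Q" "q \<in> Q" using push(3) assms(2) moves_states pops_states by blast+
  then have "(summary_of (Sym y # w), p1, f2, Some q) \<in> behaviour_above w"
    unfolding behaviour_above_level[OF w push(4), of y] next_level_def
    using push(5) assms(2) s by (auto simp: universe_def)
  then show ?thesis using chain_return[OF push(2,3)] push(1) by blast
qed

text \<open>The chain is unwound from the top. A segment that ends in acceptance without its pop
  becomes an entry with result \<open>None\<close>, which is an acceptance after a push for the
  segment below, and so on down to the bottom symbol. The flags are joined on the way.\<close>

lemma chain_accept:
  "chain w p f \<Longrightarrow> lacc (behaviour_above w) (summary_of w) p f' \<Longrightarrow>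
    (summary_of [Bot], init M, f \<or> f', None) \<in> level N"
proof (induction arbitrary: f' rule: chain.induct)
  case (base p f)
  have "chain [Bot] p f" using base.hyps by (rule chain.base)
  then have "summary_of [Bot] \<in> summaries" using chain_props by blast
  moreover have "init M \<in> Q" using sa by (simp add: stack_automaton_def)
  ultimately show ?case using base unfolding level_eq[of N] next_level_def
    by (auto simp: universe_def)
next
  case (push w p f p1 y p2 f2)
  have "chain (Sym y # w) p2 (f \<or> f2)" using push.hyps by (rule chain.push)
  then have s: "summary_of (Sym y # w) \<in> summaries" using chain_props by blast
  have w: "w \<noteq> []" using chain_props[OF push.hyps(1)] by blast
  have "p1 \<in> Q" using push.hyps(2) moves_states by blast
  then have "(summary_of (Sym y # w), p1, f2 \<or> f', None) \<in> behaviour_above w"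
    unfolding behaviour_above_level[OF w push.hyps(3), of y] next_level_def
    using push.hyps(4) push.prems s by (auto simp: universe_def)
  then have "lacc (behaviour_above w) (summary_of w) p (f2 \<or> f')"
    using push.hyps(2) w by (auto simp: lacc_def)
  then show ?case using push.IH by (simp add: disj_assoc)
qed

end

section \<open>Completeness: reading moves inside the stack\<close>

text \<open>\<open>a\<close> is the part of \<open>w\<close> up to the scanned symbol. The reading
  path is cut at the last descent from each symbol above \<open>a\<close>; what precedes such a
  descent at that symbol returns to it and is a sweep.\<close>

inductive excursion :: "'g stksym list \<Rightarrow> 'q \<Rightarrow> 'q \<Rightarrow> 'g stksym list \<Rightarrow> bool" where
  here: "(p, q) \<in> sweep (summary_of w) \<Longrightarrow> excursion w p q w"
| deeper: "(p, p1) \<in> sweep (summary_of (y # w)) \<Longrightarrow> (p1, p2) \<in> down y \<Longrightarrow> excursion w p2 q a \<Longrightarrow>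
    excursion (y # w) p q a"

lemma excursion_length: "excursion w p q a \<Longrightarrow> length a \<le> length w"
  by (induction rule: excursion.induct) auto

lemma excursion_same: "excursion w p q w \<Longrightarrow> (p, q) \<in> sweep (summary_of w)"
  by (erule excursion.cases) (auto dest: excursion_length)

lemma sweep_trans:
  "(p, q) \<in> sweep (summary_of w) \<Longrightarrow> (q, r) \<in> sweep (summary_of w) \<Longrightarrow> (p, r) \<in> sweep (summary_of w)"
  by (cases w) (auto simp: sweep_extend)

lemma sweep_none: "(q, r) \<in> none y \<Longrightarrow> (q, r) \<in> sweep (summary_of (y # w))"
  using moves_states by (auto simp: sweep_extend)

lemma excursion_none:
  "excursion w p q a \<Longrightarrow> a \<noteq> [] \<Longrightarrow> (q, r) \<in> none (hd a) \<Longrightarrow> excursion w p r a"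
proof (induction rule: excursion.induct)
  case (here p q w)
  then show ?case using sweep_trans sweep_none[of q r "hd w" "tl w"]
    by (metis excursion.here list.collapse)
qed (auto intro: excursion.deeper)

lemma excursion_down:
  "excursion w p q (x # a) \<Longrightarrow> (q, r) \<in> down x \<Longrightarrow> a \<noteq> [] \<Longrightarrow> excursion w p r a"
proof (induction w p q "x # a" rule: excursion.induct)
  case (here p q)
  have "r \<in> Q" using here(2) down_states by blast
  then show ?case using here excursion.deeper excursion.here sweep_refl by metis
qed (auto intro: excursion.deeper)

text \<open>Moving up revokes the last descent: the descent from \<open>y\<close>, the sweep of
  \<open>a\<close> and the step up form one generator of the sweep of \<open>y # a\<close>.\<close>

lemma excursion_up:
  "excursion w p q a \<Longrightarrow> w = b @ y # a \<Longrightarrow> a \<noteq> [] \<Longrightarrow> (q, r) \<in> up (hd a) \<Longrightarrow> excursion w p r (y # a)"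
proof (induction arbitrary: b rule: excursion.induct)
  case (here p q w)
  then have "length w = length (b @ y # w)" by simp
  then show ?case by simp
next
  case (deeper p p1 z w p2 q a)
  show ?case
  proof (cases b)
    case Nil
    then have z: "z = y" "w = a" using deeper.prems by auto
    have "(p2, q) \<in> sweep (summary_of a)" using deeper.hyps(3) z by (auto dest: excursion_same)
    then have "(p1, r) \<in> down y O sweep (summary_of a) O up (symb (summary_of a))"
      using deeper z by auto
    moreover have "r \<in> Q" "p1 \<in> Q" using deeper.prems deeper.hyps moves_states down_states by blast+
    ultimately have "(p1, r) \<in> sweep (summary_of (y # a))" by (auto simp: sweep_extend)
    then show ?thesis using deeper.hyps(1) z sweep_trans excursion.here by metis
  next
    case (Cons z' b')
    then show ?thesis using deeper excursion.deeper by auto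
  qed
qed

lemma excursion_hits: "excursion w p q a \<Longrightarrow> a \<noteq> [] \<Longrightarrow> q \<in> Fin \<Longrightarrow> p \<in> hits (summary_of w)"
proof (induction rule: excursion.induct)
  case (here p q w)
  then show ?case by (cases w) (auto simp: hits_extend)
qed (auto simp: hits_extend)

text \<open>\<open>w\<close> is the stack content without \<open>Top\<close> and \<open>p\<close> a
  state that the run had at the top of \<open>w\<close>; the reading moves made since are kept apart
  from the chain. The flag of the chain is tied to the peak \<open>m\<close>.\<close>

definition tracked :: "nat \<Rightarrow> nat \<Rightarrow> ('q, 'g) iconfig \<Rightarrow> bool" where
  "tracked N m c \<longleftrightarrow> (\<exists>w p q a b. c = (q, a, b) \<and> chain N w p (m = N) \<and>
     (a = Top # w \<and> b = [] \<and> (p, q) \<in> topx (hd w) \<or>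
      (\<exists>b0. b = b0 @ [Top] \<and> w = rev b0 @ a \<and> a \<noteq> [] \<and> excursion w p q a)))"

lemma tracked_at_top:
  assumes "chain N w p (m = N)" shows "tracked N m (p, w, [Top])"
proof -
  have "w \<noteq> []" "p \<in> Q" using chain_props[OF assms] by auto
  then show ?thesis unfolding tracked_def using assms sweep_refl excursion.here by fastforce
qed

text \<open>With the head back at the top, the excursion is a sweep and is absorbed into the chain
  as a local step, so that \<open>q\<close> itself becomes the state of the chain.\<close>

lemma tracked_cases:
  assumes "tracked N m (q, a, b)"
  obtains (top) "chain N a q (m = N)" "b = [Top]" "Top \<notin> set a" "a \<noteq> []"
    | (above) w p where "chain N w p (m = N)" "a = Top # w" "b = []" "(p, q) \<in> topx (hd w)"
    | (inside) w p y b0 where "chain N w p (m = N)" "b = y # b0 @ [Top]" "w = rev b0 @ y # a" "a \<noteq> []"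
        "excursion w p q a"
proof -
  from assms obtain w p where w: "chain N w p (m = N)" and
     "a = Top # w \<and> b = [] \<and> (p, q) \<in> topx (hd w) \<or>
      (\<exists>b0. b = b0 @ [Top] \<and> w = rev b0 @ a \<and> a \<noteq> [] \<and> excursion w p q a)"
    unfolding tracked_def by auto
  then consider "a = Top # w" "b = []" "(p, q) \<in> topx (hd w)"
    | b0 where "b = b0 @ [Top]" "w = rev b0 @ a" "a \<noteq> []" "excursion w p q a" by blast
  then show ?thesis
  proof cases
    case 2
    show ?thesis
    proof (cases b0)
      case Nil
      with 2 have "w = a" "(p, q) \<in> local (summary_of a)"
        by (auto simp: local_def dest: excursion_same)
      then show ?thesis using top 2 Nil w chain_local chain_props[OF w] by simp
    next
      case (Cons y b')
      then show ?thesis using inside[OF w, of y b'] 2 by simp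
    qed
  qed (use w above in blast)
qed

lemma tracked_inside:
  assumes "chain N w p (m = N)" "w = rev b0 @ a" "a \<noteq> []" "excursion w p q a"
  shows "tracked N m (q, a, b0 @ [Top])"
  using assms unfolding tracked_def by blast

lemma tracked_init: "tracked N 0 (init M, [Bot], [Top])"
proof (rule tracked_at_top)
  have "chain N [Bot] (init M) (N = 0)" by (rule chain.base) simp
  then show "chain N [Bot] (init M) (0 = N)" by (simp only: eq_commute[of 0 N])
qed

lemma tracked_step:
  assumes tr: "tracked N m c" and st: "istep c c'" and N: "max m (iconfig_size c') \<le> N"
    and m: "iconfig_size c \<le> m"
  shows "tracked N (max m (iconfig_size c')) c'"
proof -
  obtain q a b p a' b' where c: "c = (q, a, b)" "c' = (p, a', b')" by (metis prod_cases3)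
  obtain i where i: "(q, p) \<in> moves (hd a) i" "apply_instr i a b = Some (a', b')" and a: "a \<noteq> []"
    using st c by auto
  show ?thesis using tr[unfolded c(1)]
  proof (cases rule: tracked_cases)
    case top
    have loc: "chain N a p (m = N)" if "(q, p) \<in> local (summary_of a)"
      using chain_local[OF top(1) that] .
    have last: "last a = Bot" using chain_props[OF top(1)] by simp
    show ?thesis
    proof (cases i)
      case Stay
      then show ?thesis using i top m c loc tracked_at_top by (auto simp: local_def max_def)
    next
      case (Push y)
      have "chain N (Sym y # a) p ((m = N) \<or> (length a = N))"
        by (rule chain.push[OF top(1)]) (use i Push N c top in auto)
      \<comment> \<open>Both numbers are at most \<open>N\<close>, and \<open>length a\<close> is
        the size after the push.\<close>
      moreover have "(m = N \<or> length a = N) = (max m (length a) = N)"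
        using N c i Push top by auto
      ultimately show ?thesis using i Push top c tracked_at_top[of N "Sym y # a" p "max m (length a)"]
        by auto
    next
      case Pop
      then have x: "hd a \<noteq> Bot" "a' = tl a" "b' = [Top]" using i top by (auto split: if_splits)
      \<comment> \<open>The pop excludes \<open>Bot\<close> and the chain excludes
        \<open>Top\<close>, so the popped symbol is one that a push created.\<close>
      moreover have "hd a \<noteq> Top" using top by (cases a) auto
      ultimately obtain y where y: "a = Sym y # tl a" using a by (cases a; cases "hd a") auto
      have "chain N (tl a) p (m = N)"
        by (rule chain_pop[of N y]) (use y top i Pop in \<open>auto simp: pops_def\<close>, metis y list.sel(1) i(1))
      then show ?thesis using x c m tracked_at_top[of N "tl a" p m] top by (simp add: max_absorb1)
    next
      case MoveDown
      then have x: "hd a \<noteq> Bot" "a' = tl a" "b' = hd a # [Top]" using i top by (auto split: if_splits)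
      have d: "(q, p) \<in> down (hd a)" using x i MoveDown by (simp add: down_def)
      \<comment> \<open>\<open>a\<close> ends with \<open>Bot\<close> but does not begin with
        it.\<close>
      have "tl a \<noteq> []" using x last by (metis a last_ConsL list.collapse)
      moreover have "excursion a q q (hd a # tl a)"
        using top a chain_props[OF top(1)] sweep_refl excursion.here by (metis list.collapse)
      ultimately have "excursion a q p (tl a)" using d excursion_down by blast
      then have "tracked N m (p, tl a, [hd a] @ [Top])"
        using top(1) \<open>tl a \<noteq> []\<close> a by (intro tracked_inside[OF top(1)]) auto
      then show ?thesis using x c m a top by (cases a) (auto simp: max_def)
    next
      case MoveNone
      then have "(q, p) \<in> local (summary_of a)" using i a sweep_none[of q p "hd a" "tl a"]
        by (auto simp: local_def)
      then show ?thesis using i top m c loc MoveNone tracked_at_top by (auto simp: max_def)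
    next
      case MoveUp
      then have "(q, p) \<in> topx (hd a)" using i by (auto simp: topx_def)
      then have "tracked N m (p, Top # a, [])" using top(1) unfolding tracked_def by blast
      then show ?thesis using i MoveUp top c m by (auto simp: max_def)
    qed
  next
    case (above w p0)
    have p0: "(p0, p) \<in> topx (hd w)" if "(q, p) \<in> none Top"
      using above(4) that unfolding topx_def by (meson relcomp.cases relcomp.intros rtrancl_into_rtrancl)
    have w: "w \<noteq> []" using chain_props[OF above(1)] by blast
    show ?thesis
    proof (cases i)
      case MoveDown
      then have "(p0, p) \<in> local (summary_of w)"
        using i above w by (auto simp: local_def down_def)
      then have "tracked N m (p, w, [Top])" using above(1) chain_local tracked_at_top by blast
      then show ?thesis using i MoveDown above c m by (auto simp: max_def)
    next
      case MoveNone
      then have "tracked N m (p, Top # w, [])" using p0 i above unfolding tracked_def by auto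
      then show ?thesis using i MoveNone above c m by (auto simp: max_def)
    qed (use i above in auto)
  next
    case (inside w p0 y b0)
    have last: "last a = Bot" using chain_props[OF inside(1)] inside by simp
    have b: "b \<noteq> [Top]" using inside by simp
    show ?thesis
    proof (cases i)
      case MoveDown
      then have x: "hd a \<noteq> Bot" "a' = tl a" "b' = hd a # b" using i by (auto split: if_splits)
      have d: "(q, p) \<in> down (hd a)" using x i MoveDown by (simp add: down_def)
      have "tl a \<noteq> []" using x last by (metis a last_ConsL list.collapse)
      then have "excursion w p0 p (tl a)" using inside a d excursion_down by (metis list.collapse)
      then have "tracked N m (p, tl a, (hd a # y # b0) @ [Top])"
        using inside \<open>tl a \<noteq> []\<close> a by (intro tracked_inside[OF inside(1)]) auto
      then show ?thesis using x c m a inside by (cases a) (auto simp: max_def)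
    next
      case MoveNone
      then have "excursion w p0 p a" using inside i excursion_none by blast
      then have "tracked N m (p, a, (y # b0) @ [Top])"
        using inside by (intro tracked_inside[OF inside(1)]) auto
      then show ?thesis using i c m inside MoveNone by (auto simp: max_def)
    next
      case MoveUp
      then have "excursion w p0 p (y # a)"
        using inside i by (intro excursion_up[of w p0 q a "rev b0"]) auto
      then have "tracked N m (p, y # a, b0 @ [Top])"
        using inside by (intro tracked_inside[OF inside(1)]) auto
      then show ?thesis using i c m inside MoveUp by (auto simp: max_def)
    qed (use i b in auto)
  qed
qed

lemma nreach_size: "nreach m c \<Longrightarrow> iconfig_size c \<le> m"
proof (induction rule: rtranclp_induct2)
  case (step m c m' c')
  then show ?case by simp
qed simp

lemma tracked_if_nreach: "nreach m c \<Longrightarrow> m \<le> N \<Longrightarrow> tracked N m c"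
proof (induction rule: rtranclp_induct2)
  case refl
  then show ?case by (simp add: tracked_init)
next
  case (step m c m' c')
  then have "istep c c'" "m' = max m (iconfig_size c')" by simp_all
  then show ?case using step tracked_step[of N m c c'] nreach_size[OF step.hyps(1)] by simp
qed

lemma accept_if_tracked:
  assumes "tracked N N (q, a, b)" "q \<in> Fin"
  shows "(summary_of [Bot], init M, True, None) \<in> level N"
proof -
  obtain w p where w: "chain N w p True" and
     "a = Top # w \<and> b = [] \<and> (p, q) \<in> topx (hd w) \<or>
      (\<exists>b0. b = b0 @ [Top] \<and> w = rev b0 @ a \<and> a \<noteq> [] \<and> excursion w p q a)"
    using assms(1) unfolding tracked_def by auto
  then have "p \<in> accepts (summary_of w)"
    using assms(2) chain_props[OF w] by (auto simp: accepts_def dest: excursion_hits)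
  then show ?thesis using chain_accept[OF w, of False] by (simp add: lacc_def)
qed

lemma peak_iff_level:
  "(\<exists>c. nreach N c \<and> fst c \<in> Fin) \<longleftrightarrow> (summary_of [Bot], init M, True, None) \<in> level N"
proof
  assume "\<exists>c. nreach N c \<and> fst c \<in> Fin"
  then show "(summary_of [Bot], init M, True, None) \<in> level N"
    using tracked_if_nreach accept_if_tracked by fastforce
next
  assume *: "(summary_of [Bot], init M, True, None) \<in> level N"
  have "realized N (level N) [Bot]" by (rule level_realized) auto
  then show "\<exists>c. nreach N c \<and> fst c \<in> Fin"
    by (rule realizedD[OF _ *, of _ 0]) force+
qed

section \<open>Periodicity of the levels and the size of their universe\<close>

lemma finite_universe: "finite universe"
  using sa unfolding universe_def summaries_def stack_automaton_def by auto

lemma unbounded_iff: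
  assumes "2 ^ card universe \<le> K"
  shows "(\<forall>B. \<exists>m>B. \<exists>c. nreach m c \<and> fst c \<in> Fin) \<longleftrightarrow>
    (\<exists>m c. K \<le> m \<and> m \<le> 2 * K \<and> nreach m c \<and> fst c \<in> Fin)"
proof -
  have "(\<forall>B. \<exists>m>B. (summary_of [Bot], init M, True, None) \<in> level m) \<longleftrightarrow>
    (\<exists>m. K \<le> m \<and> m \<le> 2 * K \<and> (summary_of [Bot], init M, True, None) \<in> level m)"
    by (rule iterate_unbounded_iff[where F = "next_level False" and X = "Pow universe"])
      (use level_universe finite_universe assms in \<open>auto simp: card_Pow\<close>)
  then show ?thesis unfolding peak_iff_level[symmetric] by blast
qed

text \<open>Each factor is bounded by a power of two, so the exponents add up: \<open>n * n\<close>
  for the relations on states, \<open>4 * n\<close> for the four factors below \<open>2 ^ n\<close>,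
  and \<open>1\<close> for the flag. Asking only for upper bounds spares the procedure from counting
  distinct names in the lists of a description.\<close>

lemma card_universe_le:
  assumes "card Q \<le> n" "card (stack0 M) \<le> n"
  shows "card universe \<le> 2 ^ (n * n + 4 * n + 1)"
proof -
  have fin: "finite Q" "finite (stack0 M)" using sa by (auto simp: stack_automaton_def)
  have n: "k \<le> n \<Longrightarrow> k \<le> 2 ^ n" for k :: nat by (meson less_exp less_imp_le order_trans)
  have n1: "k \<le> n \<Longrightarrow> Suc k \<le> 2 ^ n" for k :: nat by (meson Suc_leI less_exp le_less_trans)
  have "card (insert Bot (Sym ` stack0 M)) \<le> 2 ^ n"
    using fin assms(2) by (intro n1[THEN order_trans[rotated]])
      (auto simp: card_insert_if intro: le_trans[OF card_image_le])
  moreover have "card (Pow (Q \<times> Q)) \<le> 2 ^ (n * n)"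
    using fin assms(1) by (simp add: card_Pow card_cartesian_product mult_le_mono)
  moreover have "card (Pow Q) \<le> 2 ^ n" using fin assms(1) by (simp add: card_Pow)
  moreover have "card (insert None (Some ` Q)) \<le> 2 ^ n"
    using fin n1[OF assms(1)] by (simp add: card_image)
  moreover have "card Q \<le> 2 ^ n" using n assms(1) by blast
  moreover have "card (UNIV :: bool set) \<le> 2 ^ 1" by simp
  ultimately have "card universe \<le> (2 ^ n * (2 ^ (n * n) * 2 ^ n)) * (2 ^ n * (2 ^ 1 * 2 ^ n))"
    unfolding universe_def summaries_def card_cartesian_product by (intro mult_le_mono)
  also have "\<dots> = 2 ^ ((n + (n * n + n)) + (n + (1 + n)))" by (simp only: power_add)
  also have "(n + (n * n + n)) + (n + (1 + n)) = n * n + 4 * n + 1" by simp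
  finally show ?thesis .
qed

end

section \<open>Dropping the input\<close>

fun forget_input :: "('q, 'a, 'g) config \<Rightarrow> ('q, 'g) iconfig" where
  "forget_input (q, w, \<alpha>, \<beta>) = (q, rev \<alpha>, \<beta>)"

fun append_input :: "'a list \<Rightarrow> ('q, 'a, 'g) config \<Rightarrow> ('q, 'a, 'g) config" where
  "append_input v (q, w, \<alpha>, \<beta>) = (q, w @ v, \<alpha>, \<beta>)"

definition targets :: "measure_kind \<Rightarrow> ('q, 'a, 'g) sa \<Rightarrow> 'q set" where
  "targets z M = (case z of Accept \<Rightarrow> finals M | Strong \<Rightarrow> states M)"

definition observed ::
  "measure_kind \<Rightarrow> ('q, 'a, 'g) sa \<Rightarrow> 'a list \<Rightarrow> ('q, 'a, 'g) config list \<Rightarrow> bool" where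
  "observed z M u cs = (case z of Accept \<Rightarrow> accepting_computation M u cs
     | Strong \<Rightarrow> partial_computation M u cs)"

text \<open>A word outside the language has no accepting computation, so its value \<open>0\<close>
  agrees with the vacuous right-hand side.\<close>

lemma word_space_le_iff:
  "u \<in> lists (inputs M) \<Longrightarrow>
    word_space z M u \<le> enat K \<longleftrightarrow> (\<forall>cs. observed z M u cs \<longrightarrow> comp_size cs \<le> K)"
  by (cases z) (auto simp: SUP_le_iff observed_def accepted_language_def)

lemma sa_space_le_iff:
  "sa_space z M n \<le> enat K \<longleftrightarrow>
    (\<forall>u\<in>lists (inputs M). length u = n \<longrightarrow> (\<forall>cs. observed z M u cs \<longrightarrow> comp_size cs \<le> K))"
  unfolding sa_space_def SUP_le_iff by (auto simp: word_space_le_iff)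

text \<open>By the convention on \<open>\<infinity>\<close> the finitely many initial values are
  finite, so an eventual bound extends to all \<open>n\<close>.\<close>

lemma enat_bigo_1_iff: "enat_bigo s (\<lambda>n. 1) \<longleftrightarrow> (\<exists>K. \<forall>n. s n \<le> enat K)"
proof
  assume "enat_bigo s (\<lambda>n. 1)"
  then have fin: "s n \<noteq> \<infinity>" and "(\<lambda>n. real (the_enat (s n))) \<in> O(\<lambda>n. 1)" for n
    by (auto simp: enat_bigo_def)
  then obtain c where "eventually (\<lambda>n. norm (real (the_enat (s n))) \<le> c * norm (1::real)) at_top"
    by (auto elim: landau_o.bigE)
  then obtain N where N: "real (the_enat (s n)) \<le> c" if "n \<ge> N" for n
    by (auto simp: eventually_at_top_linorder)
  define K where "K = Max ((\<lambda>n. the_enat (s n)) ` {..N}) + nat \<lceil>c\<rceil>"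
  have "the_enat (s n) \<le> K" for n
  proof (cases "n \<le> N")
    case True
    then show ?thesis unfolding K_def by (intro trans_le_add1 Max_ge) auto
  next
    case False
    then have "real (the_enat (s n)) \<le> c" using N by simp
    then have "the_enat (s n) \<le> nat \<lceil>c\<rceil>" by linarith
    then show ?thesis unfolding K_def by simp
  qed
  then have "s n \<le> enat K" for n using fin[of n] by (cases "s n") (simp_all, metis the_enat.simps)
  then show "\<exists>K. \<forall>n. s n \<le> enat K" by blast
next
  assume "\<exists>K. \<forall>n. s n \<le> enat K"
  then obtain K where K: "s n \<le> enat K" for n by blast
  have fin: "s n \<noteq> \<infinity>" for n using K[of n] by (cases "s n") auto
  \<comment> \<open>\<open>Suc K\<close> instead of \<open>K\<close>, since the introduction rule
    for \<open>O\<close> asks for a positive constant.\<close>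
  have "the_enat (s n) \<le> Suc K" for n using K[of n] fin[of n] by (cases "s n") auto
  then have "real (the_enat (s n)) \<le> real (Suc K)" for n by (simp only: of_nat_le_iff)
  then have "(\<lambda>n. real (the_enat (s n))) \<in> O(\<lambda>n. 1)"
    by (intro landau_o.bigI[of "real (Suc K)"] always_eventually allI) simp_all
  with fin show "enat_bigo s (\<lambda>n. 1)" by (simp add: enat_bigo_def)
qed

context sa_with_targets
begin

section \<open>Simulation between runs with and without input\<close>

lemma istep_if_step: "step M c c' \<Longrightarrow> istep (forget_input c) (forget_input c')"
  unfolding step_def
proof (elim disjE)
  assume "write_step M c c'"
  then show ?thesis
  proof cases
    case (write_stay q a x p u \<gamma>)
    then show ?thesis by (auto simp: moves_def intro!: exI[of _ Stay])
  next
    case (write_push q a x p y u \<gamma>)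
    then show ?thesis by (auto simp: moves_def intro!: exI[of _ "Push y"])
  next
    case (write_pop q a x p u \<gamma>)
    then show ?thesis by (auto simp: moves_def intro!: exI[of _ Pop])
  qed
next
  assume "read_step M c c'"
  then show ?thesis
  proof cases
    case (read_down q a x p u \<gamma>1 \<gamma>2)
    then show ?thesis by (auto simp: moves_def intro!: exI[of _ MoveDown])
  next
    case (read_none q a x p u \<gamma>1 \<gamma>2)
    then show ?thesis by (auto simp: moves_def intro!: exI[of _ MoveNone])
  next
    case (read_up q a x p u \<gamma>1 y \<gamma>2)
    then show ?thesis by (auto simp: moves_def intro!: exI[of _ MoveUp])
  qed
qed

lemma stacks_snoc_Top: "\<gamma> @ [Top] \<in> stacks M \<longleftrightarrow> (\<exists>g. \<gamma> = Bot # map Sym g \<and> set g \<subseteq> stack0 M)"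
  unfolding stacks_def by (auto simp flip: append_Cons)

lemma stacks_top_symbol: "\<gamma> @ [x, Top] \<in> stacks M \<Longrightarrow> x \<in> insert Bot (Sym ` stack0 M)"
proof -
  assume "\<gamma> @ [x, Top] \<in> stacks M"
  then obtain g where "\<gamma> @ [x] = Bot # map Sym g" "set g \<subseteq> stack0 M"
    using stacks_snoc_Top[of "\<gamma> @ [x]"] by auto
  then have "x \<in> set (Bot # map Sym g)" by (metis in_set_conv_decomp)
  then show ?thesis using \<open>set g \<subseteq> stack0 M\<close> by auto
qed

lemma istep_stacks:
  assumes "istep (q, a, b) (p, a', b')" "rev a @ b \<in> stacks M"
  shows "rev a' @ b' \<in> stacks M"
proof -
  obtain i where i: "(q, p) \<in> moves (hd a) i" "apply_instr i a b = Some (a', b')" "a \<noteq> []"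
    using assms(1) by auto
  obtain x v where a: "a = x # v" using i(3) by (cases a) auto
  show ?thesis
  proof (cases i)
    case (Push y)
    then have "y \<in> stack0 M" using i(1) moves_Push by blast
    then obtain g where "rev a = Bot # map Sym g" "set g \<subseteq> stack0 M"
      using assms(2) i Push stacks_snoc_Top[of "rev a"] by (auto split: if_splits)
    then show ?thesis using i Push \<open>y \<in> stack0 M\<close> stacks_snoc_Top[of "rev a'"]
      by (auto split: if_splits intro!: exI[of _ "g @ [y]"])
  next
    case Pop
    then have x: "x \<noteq> Bot" "a' = v" "b' = [Top]" "b = [Top]" using i a by (auto split: if_splits)
    then obtain g where g: "rev v @ [x] = Bot # map Sym g" "set g \<subseteq> stack0 M"
      using assms(2) a stacks_snoc_Top[of "rev v @ [x]"] by auto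
    then have "g \<noteq> []" using x(1) by (cases "rev v") auto
    then obtain h y where h: "g = h @ [y]" by (metis rev_exhaust)
    with g have "rev v = Bot # map Sym h" by (simp flip: append_Cons)
    then show ?thesis using x g h stacks_snoc_Top[of "rev v"] by auto
  qed (use assms(2) i a in \<open>auto split: if_splits\<close>)
qed

lemma step_if_istep:
  assumes "istep (q, a, b) (p, a', b')" "rev a @ b \<in> stacks M"
  shows "\<exists>l. letter l \<in> lists (inputs M) \<and>
    step M (q, letter l, rev a, b) (p, [], rev a', b')"
proof -
  obtain i where i: "(q, p) \<in> moves (hd a) i" "apply_instr i a b = Some (a', b')" "a \<noteq> []"
    using assms(1) by auto
  obtain x v where a: "a = x # v" using i(3) by (cases a) auto
  obtain l where l: "((q, l, x), (p, i)) \<in> transitions M" using i(1) a by (auto simp: moves_def)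
  then have "l \<in> insert None (Some ` inputs M)" using sa by (auto simp: stack_automaton_def)
  then have "letter l \<in> lists (inputs M)" by auto
  moreover have "step M (q, letter l @ [], rev a, b) (p, [], rev a', b')"
  proof (cases i)
    case Stay
    then have "b = [Top]" "a' = a" "b' = b" using i by (auto split: if_splits)
    then show ?thesis using l a Stay assms(2) stacks_top_symbol[of "rev v" x]
      by (auto simp: step_def simp del: append_Nil2 intro!: write_stay)
  next
    case (Push y)
    then have "b = [Top]" "a' = Sym y # a" "b' = b" using i by (auto split: if_splits)
    then show ?thesis using l a Push assms(2) stacks_top_symbol[of "rev v" x]
      by (auto simp: step_def simp del: append_Nil2 intro!: write_push)
  next
    case Pop
    then have "b = [Top]" "a' = v" "b' = b" "x \<noteq> Bot" using i a by (auto split: if_splits)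
    then show ?thesis using l a Pop assms(2) stacks_top_symbol[of "rev v" x]
      by (auto simp: step_def simp del: append_Nil2 intro!: write_pop)
  next
    case MoveDown
    then have "a' = v" "b' = x # b" "x \<noteq> Bot" using i a by (auto split: if_splits)
    then show ?thesis using l a MoveDown assms(2)
      by (auto simp: step_def simp del: append_Nil2 intro!: read_down)
  next
    case MoveNone
    then have "a' = a" "b' = b" using i a by (auto split: if_splits)
    then show ?thesis using l a MoveNone assms(2)
      by (auto simp: step_def simp del: append_Nil2 intro!: read_none)
  next
    case MoveUp
    then obtain y c where "b = y # c" "a' = y # a" "b' = c" using i a by (cases b) auto
    then show ?thesis using l a MoveUp assms(2)
      by (auto simp: step_def simp del: append_Nil2 intro!: read_up)
  qed
  ultimately show ?thesis by auto
qed

lemma step_append_input: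
  assumes "step M c c'" "v \<in> lists (inputs M)"
  shows "step M (append_input v c) (append_input v c')"
  using assms(1) unfolding step_def
proof (elim disjE)
  assume "write_step M c c'"
  then have "write_step M (append_input v c) (append_input v c')"
    by cases (use assms(2) in
      \<open>auto intro!: write_step.intros simp del: insert_iff in_lists_conv_set\<close>)
  then show "write_step M (append_input v c) (append_input v c') \<or>
    read_step M (append_input v c) (append_input v c')" ..
next
  assume "read_step M c c'"
  then have "read_step M (append_input v c) (append_input v c')"
  proof cases
    case (read_down q a x p u \<gamma>1 \<gamma>2)
    then show ?thesis using assms(2) read_step.read_down[of q a x p M "u @ v" \<gamma>1 \<gamma>2] by simp
  next
    case (read_none q a x p u \<gamma>1 \<gamma>2)
    then show ?thesis using assms(2) read_step.read_none[of q a x p M "u @ v" \<gamma>1 \<gamma>2] by simp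
  next
    case (read_up q a x p u \<gamma>1 y \<gamma>2)
    then show ?thesis using assms(2) read_step.read_up[of q a x p M "u @ v" \<gamma>1 y \<gamma>2] by simp
  qed
  then show "write_step M (append_input v c) (append_input v c') \<or>
    read_step M (append_input v c) (append_input v c')" ..
qed

lemma iconfig_size_forget_input: "iconfig_size (forget_input c) = stack_size c"
  by (cases c) simp

lemma comp_size_snoc: "cs \<noteq> [] \<Longrightarrow> comp_size (cs @ [c]) = max (comp_size cs) (stack_size c)"
  by (simp add: comp_size_def max.commute)

lemma nreach_if_partial_computation:
  "partial_computation M u cs \<Longrightarrow> nreach (comp_size cs) (forget_input (last cs))"
proof (induction cs rule: rev_induct)
  case (snoc c cs)
  show ?case
  proof (cases "cs = []")
    case True
    then show ?thesis using snoc.prems by (simp add: partial_computation_def comp_size_def)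
  next
    case False
    then have "partial_computation M u cs" "step M (last cs) c"
      using snoc.prems by (auto simp: partial_computation_def successively_append_iff)
    then have "nreach (comp_size cs) (forget_input (last cs))"
      "tstep (comp_size cs, forget_input (last cs)) (comp_size (cs @ [c]), forget_input c)"
      using snoc.IH False by (simp_all add: istep_if_step comp_size_snoc iconfig_size_forget_input)
    then show ?thesis unfolding last_snoc by (rule rtranclp.rtrancl_into_rtrancl)
  qed
qed (simp add: partial_computation_def)

text \<open>The word is collected along the run: a letter needed by the next transition is appended
  to the remaining input of all earlier configurations. The run thus always ends with empty
  remaining input, and acceptance depends on the last state alone.\<close>

lemma computation_if_nreach:
  "nreach m (q, a, b) \<Longrightarrow> rev a @ b \<in> stacks M \<and>
    (\<exists>u\<in>lists (inputs M). \<exists>cs. partial_computation M u cs \<and> comp_size cs = m \<and>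
      last cs = (q, [], rev a, b))"
proof (induction "(m, (q, a, b))" arbitrary: m q a b rule: rtranclp_induct)
  case base
  have "[Bot, Top] \<in> stacks M" by (auto simp: stacks_def)
  then show ?case by (auto simp: partial_computation_def comp_size_def intro!: exI[of _ "[_]"])
next
  case (step c m' p a' b')
  obtain m q a b where c: "c = (m, (q, a, b))" by (metis prod_cases4)
  obtain u cs where st: "rev a @ b \<in> stacks M" and u: "u \<in> lists (inputs M)"
    "partial_computation M u cs" "comp_size cs = m" "last cs = (q, [], rev a, b)" using step.hyps(3)[OF c] by blast
  have i: "istep (q, a, b) (p, a', b')" "m' = max m (iconfig_size (p, a', b'))"
    using step.hyps(2) c by (simp_all del: istep.simps)
  obtain l where l: "letter l \<in> lists (inputs M)" "step M (q, letter l, rev a, b) (p, [], rev a', b')"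
    using step_if_istep[OF i(1) st] by blast
  have ne: "cs \<noteq> []" using u(2) by (simp add: partial_computation_def)
  define ds where "ds = map (append_input (letter l)) cs"
  have "successively (step M) ds"
    using u(2) step_append_input[OF _ l(1)] unfolding ds_def successively_map partial_computation_def
    by (auto elim!: successively_mono)
  moreover have "hd ds = (init M, u @ letter l, [Bot], [Top])"
    using u(2) ne by (simp add: ds_def hd_map partial_computation_def)
  moreover have "last ds = (q, letter l, rev a, b)" using u(4) ne by (simp add: ds_def last_map)
  moreover have "stack_size (append_input v c) = stack_size c" for v and c :: "('q, 'a, 'g) config"
    by (cases c) simp
  then have "comp_size ds = m" using u(3) by (simp add: ds_def comp_size_def image_image)
  ultimately have "partial_computation M (u @ letter l) (ds @ [(p, [], rev a', b')])"
    "comp_size (ds @ [(p, [], rev a', b')]) = m'"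
    using l ne i(2) by (auto simp: partial_computation_def successively_append_iff ds_def
      comp_size_snoc)
  moreover have "u @ letter l \<in> lists (inputs M)" using u(1) l(1) by simp
  ultimately show ?case using istep_stacks[OF i(1) st] by (metis last_snoc)
qed

lemma nreach_states: "nreach m (q, a, b) \<Longrightarrow> q \<in> Q"
proof (induction "(m, (q, a, b))" arbitrary: m q a b rule: rtranclp_induct)
  case base
  then show ?case using sa by (simp add: stack_automaton_def)
next
  case (step c)
  then show ?case using moves_states by (cases c) auto
qed

text \<open>A bound uniform in the length is one bound for all words, so lengths disappear. For the
  strong measure every state reached is a target, by \<open>nreach_states\<close>.\<close>

lemma bounded_space_iff:
  assumes "Fin = targets z M"
  shows "enat_bigo (sa_space z M) (\<lambda>n. 1) \<longleftrightarrow> \<not> (\<forall>B. \<exists>m>B. \<exists>c. nreach m c \<and> fst c \<in> Fin)"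
proof -
  have 1: "\<exists>c. nreach (comp_size cs) c \<and> fst c \<in> Fin" if "observed z M u cs" for u cs
  proof -
    have p: "partial_computation M u cs"
      using that by (auto simp: observed_def accepting_computation_def computation_def
        split: measure_kind.splits)
    obtain q w \<alpha> \<beta> where l: "last cs = (q, w, \<alpha>, \<beta>)" by (metis prod_cases4)
    have n: "nreach (comp_size cs) (q, rev \<alpha>, \<beta>)" using nreach_if_partial_computation[OF p] l by simp
    moreover have "q \<in> Fin" using that nreach_states[OF n] l assms
      by (auto simp: observed_def accepting_computation_def targets_def split: measure_kind.splits)
    ultimately show ?thesis by force
  qed
  have 2: "\<exists>u\<in>lists (inputs M). \<exists>cs. observed z M u cs \<and> comp_size cs = m"
    if nr: "nreach m c" "fst c \<in> Fin" for m c
  proof -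
    obtain q a b where c: "c = (q, a, b)" by (metis prod_cases3)
    obtain u cs where "u \<in> lists (inputs M)" "partial_computation M u cs" "comp_size cs = m"
      "last cs = (q, [], rev a, b)" using computation_if_nreach[OF nr(1)[unfolded c]] by blast
    then show ?thesis using nr(2) c assms
      by (intro bexI[of _ u] exI[of _ cs])
        (auto simp: observed_def accepting_computation_def computation_def targets_def
          split: measure_kind.splits)
  qed
  show ?thesis unfolding enat_bigo_1_iff sa_space_le_iff
    using 1 2 by (metis leD linorder_not_le)
qed

end

section \<open>Codes of descriptions\<close>

text \<open>An enumeration of a reachable set certifies membership (each element is reached from an earlier
  one) as well as non-membership (the list is closed), which makes a search for it total and its
  result conclusive.\<close>

definition enumerates :: "('s \<Rightarrow> 's \<Rightarrow> bool) \<Rightarrow> 's \<Rightarrow> 's list \<Rightarrow> bool" where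
  "enumerates R s xs \<longleftrightarrow> (\<forall>i<length xs. xs ! i = s \<or> (\<exists>k<i. R (xs ! k) (xs ! i))) \<and> s \<in> set xs \<and>
     (\<forall>x\<in>set xs. \<forall>y. R x y \<longrightarrow> y \<in> set xs)"

lemma set_enumerates:
  assumes "enumerates R s xs" shows "set xs = {x. R\<^sup>*\<^sup>* s x}"
proof
  have "R\<^sup>*\<^sup>* s (xs ! i)" if "i < length xs" for i
    using that
  proof (induction i rule: less_induct)
    case (less i)
    consider "xs ! i = s" | k where "k < i" "R (xs ! k) (xs ! i)"
      using assms less.prems by (auto simp: enumerates_def)
    then show ?case
    proof cases
      case 2
      then show ?thesis using less by (meson less_trans rtranclp.rtrancl_into_rtrancl)
    qed simp
  qed
  then show "set xs \<subseteq> {x. R\<^sup>*\<^sup>* s x}" by (auto simp: in_set_conv_nth)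
next
  have "x \<in> set xs" if "R\<^sup>*\<^sup>* s x" for x
    using that by (induction rule: rtranclp_induct) (use assms in \<open>auto simp: enumerates_def\<close>)
  then show "{x. R\<^sup>*\<^sup>* s x} \<subseteq> set xs" by blast
qed

text \<open>Finiteness bounds the length of duplicate-free lists in which each entry is
  \<open>s\<close> or a successor of an earlier one. A longest such list containing \<open>s\<close>
  is closed, for otherwise a missing successor could be appended.\<close>

lemma ex_enumerates:
  assumes fin: "finite {x. R\<^sup>*\<^sup>* s x}" shows "\<exists>xs. enumerates R s xs"
proof -
  define P where "P xs \<longleftrightarrow> distinct xs \<and> set xs \<subseteq> {x. R\<^sup>*\<^sup>* s x} \<and> s \<in> set xs \<and>
    (\<forall>i<length xs. xs ! i = s \<or> (\<exists>k<i. R (xs ! k) (xs ! i)))" for xs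
  have "P [s]" by (simp add: P_def)
  moreover have "length xs < Suc (card {x. R\<^sup>*\<^sup>* s x})" if "P xs" for xs
    using that card_mono[OF fin, of "set xs"] distinct_card[of xs] by (simp add: P_def)
  ultimately obtain xs where "P xs" and max: "\<And>ys. P ys \<Longrightarrow> length ys \<le> length xs"
    using ex_has_greatest_nat[of P "[s]" length "Suc (card {x. R\<^sup>*\<^sup>* s x})"] by blast
  note xs = \<open>P xs\<close>[unfolded P_def]
  have "y \<in> set xs" if x: "x \<in> set xs" "R x y" for x y
  proof (rule ccontr)
    assume y: "y \<notin> set xs"
    obtain k where k: "k < length xs" "xs ! k = x" using x(1) by (auto simp: in_set_conv_nth)
    have "R\<^sup>*\<^sup>* s y" using xs x by (auto intro: rtranclp.rtrancl_into_rtrancl)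
    moreover have "(xs @ [y]) ! i = s \<or> (\<exists>k<i. R ((xs @ [y]) ! k) ((xs @ [y]) ! i))"
      if "i < length (xs @ [y])" for i
    proof (cases "i < length xs")
      case True
      then consider "xs ! i = s" | k where "k < i" "R (xs ! k) (xs ! i)" using xs by blast
      then show ?thesis
      proof cases
        case 2
        then show ?thesis using True by (intro disjI2 exI[of _ k]) (simp add: nth_append)
      qed (use True in \<open>simp add: nth_append\<close>)
    next
      case False
      then have "i = length xs" using that by simp
      then show ?thesis using k \<open>R x y\<close> by (intro disjI2 exI[of _ k]) (simp add: nth_append)
    qed
    ultimately have "P (xs @ [y])" using xs y by (simp add: P_def)
    from max[OF this] show False by simp
  qed
  then show ?thesis using xs unfolding enumerates_def by blast
qed

text \<open>Codes below the offsets 1, 2 and 5 stand for constructors without argument, which are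
  always admissible; subtracting the offset recovers the name to be looked up.\<close>

definition valid_trans_code :: "nat \<Rightarrow> nat \<Rightarrow> bool" where
  "valid_trans_code n t \<longleftrightarrow> llen t = 5 \<and> lmem (lnth t 0) (lnth n 0) \<and>
     (lnth t 1 = 0 \<or> lmem (lnth t 1 - 1) (lnth n 1)) \<and>
     (lnth t 2 \<le> 1 \<or> lmem (lnth t 2 - 2) (lnth n 2)) \<and>
     lmem (lnth t 3) (lnth n 0) \<and> (lnth t 4 \<le> 4 \<or> lmem (lnth t 4 - 5) (lnth n 2))"

definition valid_code :: "nat \<Rightarrow> bool" where
  "valid_code n \<longleftrightarrow> llen n = 6 \<and>
     (\<forall>i<llen (lnth n 3). valid_trans_code n (lnth (lnth n 3) i)) \<and>
     lmem (lnth n 4) (lnth n 0) \<and>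
     (\<forall>i<llen (lnth n 5). lmem (lnth (lnth n 5) i) (lnth n 0))"

lemma decpred_valid_code [comp_intros]: "computable f \<Longrightarrow> decpred (\<lambda>x. valid_code (f x))"
proof (rule decpred_compose[where P = valid_code])
  show "decpred valid_code"
    unfolding valid_code_def valid_trans_code_def by (intro comp_intros)
qed

lemma encode_trans_fields [simp]:
  "llen (encode_trans ((q, l, x), (p, i))) = 5"
  "lnth (encode_trans ((q, l, x), (p, i))) 0 = q"
  "lnth (encode_trans ((q, l, x), (p, i))) (Suc 0) = encode_option l"
  "lnth (encode_trans ((q, l, x), (p, i))) 2 = encode_stksym x"
  "lnth (encode_trans ((q, l, x), (p, i))) 3 = p"
  "lnth (encode_trans ((q, l, x), (p, i))) 4 = encode_instr i"
  by (simp_all del: list_encode.simps)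

lemma encode_desc_fields [simp]:
  "llen (encode_desc D) = 6"
  "lnth (encode_desc D) 0 = list_encode (d_states D)"
  "lnth (encode_desc D) (Suc 0) = list_encode (d_inputs D)"
  "lnth (encode_desc D) 2 = list_encode (d_stack0 D)"
  "lnth (encode_desc D) 3 = list_encode (map encode_trans (d_trans D))"
  "lnth (encode_desc D) 4 = d_init D"
  "lnth (encode_desc D) 5 = list_encode (d_finals D)"
  by (simp_all add: encode_desc_def del: list_encode.simps)

lemma option_code: "encode_option l = 0 \<or> encode_option l - 1 \<in> A \<longleftrightarrow> l \<in> insert None (Some ` A)"
  by (cases l) auto

lemma stksym_code: "encode_stksym x \<le> 1 \<or> encode_stksym x - 2 \<in> A \<longleftrightarrow> x \<in> {Bot, Top} \<union> Sym ` A"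
  by (cases x) auto

lemma instr_code: "encode_instr i \<le> 4 \<or> encode_instr i - 5 \<in> A \<longleftrightarrow>
    i \<in> {Stay, Pop, MoveDown, MoveNone, MoveUp} \<union> Push ` A"
  by (cases i) auto

lemma valid_trans_code_encode:
  "valid_trans_code (encode_desc D) (encode_trans t) \<longleftrightarrow>
    t \<in> (states (sa_of D) \<times> insert None (Some ` inputs (sa_of D)) \<times> stack_alphabet (sa_of D)) \<times>
      (states (sa_of D) \<times> instrs (sa_of D))"
proof -
  obtain q l x p i where t: "t = ((q, l, x), (p, i))" by (metis prod.exhaust)
  show ?thesis
    using option_code[of l "set (d_inputs D)"] stksym_code[of x "set (d_stack0 D)"]
      instr_code[of i "set (d_stack0 D)"]
    unfolding t valid_trans_code_def stack_alphabet_def instrs_def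
    by (simp add: sa_of_def del: encode_trans.simps) blast
qed

lemma valid_code_encode: "valid_code (encode_desc D) \<longleftrightarrow> stack_automaton (sa_of D)"
proof -
  have "(\<forall>i<length (d_trans D).
      valid_trans_code (encode_desc D) (lnth (list_encode (map encode_trans (d_trans D))) i)) \<longleftrightarrow>
    (\<forall>t\<in>set (d_trans D). valid_trans_code (encode_desc D) (encode_trans t))"
    by (simp add: all_set_conv_all_nth)
  moreover have "(\<forall>i<length (d_finals D). lnth (list_encode (d_finals D)) i \<in> set (d_states D)) \<longleftrightarrow>
    set (d_finals D) \<subseteq> set (d_states D)"
    by (simp add: subset_code(1) all_set_conv_all_nth)
  ultimately show ?thesis
    by (simp add: valid_code_def stack_automaton_def valid_trans_code_encode subset_code(1))
      (simp add: sa_of_def subset_eq)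
qed

lemma surj_encode_option: "surj encode_option"
proof (rule surjI[where f = "\<lambda>n. case n of 0 \<Rightarrow> None | Suc a \<Rightarrow> Some a"])
  show "encode_option (case n of 0 \<Rightarrow> None | Suc a \<Rightarrow> Some a) = n" for n by (cases n) auto
qed

lemma surj_encode_stksym: "surj encode_stksym"
proof (rule surjI[where f = "\<lambda>n. if n = 0 then Bot else if n = 1 then Top else Sym (n - 2)"])
qed auto

lemma surj_encode_instr: "surj encode_instr"
proof (rule surjI[where f = "\<lambda>n. if n = 0 then Stay else if n = 1 then Pop else if n = 2 then MoveDown
    else if n = 3 then MoveNone else if n = 4 then MoveUp else Push (n - 5)"])
qed auto

text \<open>The component encodings are onto, so a number can fail to code a description only
  through a wrong list length, and \<open>valid_code\<close> checks the lengths 6 and 5.\<close>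

lemma valid_code_desc:
  assumes "valid_code n" shows "\<exists>D. n = encode_desc D"
proof -
  have n: "n = list_encode (list_decode n)" by simp
  then have "length (list_decode n) = 6" using assms unfolding valid_code_def by (metis llen_encode)
  then obtain a b c d e f where l: "list_decode n = [a, b, c, d, e, f]"
    by (auto simp: numeral_eq_Suc length_Suc_conv)
  have d: "lnth n 3 = list_encode (list_decode d)" using n l lnth_encode[of 3 "list_decode n"]
    by (simp del: list_encode.simps)
  have "\<exists>t. x = encode_trans t" if x: "x \<in> set (list_decode d)" for x
  proof -
    obtain i where "i < length (list_decode d)" "list_decode d ! i = x"
      using x by (auto simp: in_set_conv_nth)
    then have "llen x = 5" using assms d unfolding valid_code_def valid_trans_code_def
      by (metis llen_encode lnth_encode)
    then have "length (list_decode x) = 5" by (metis llen_encode list_decode_inverse)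
    then obtain q l y p i where "list_decode x = [q, l, y, p, i]"
      by (auto simp: numeral_eq_Suc length_Suc_conv)
    moreover obtain l' y' i' where "l = encode_option l'" "y = encode_stksym y'" "i = encode_instr i'"
      using surj_encode_option surj_encode_stksym surj_encode_instr by (metis surjD)
    ultimately have "x = encode_trans ((q, l', y'), (p, i'))"
      by (metis encode_trans.simps list_decode_inverse)
    then show ?thesis by blast
  qed
  then have "map (encode_trans \<circ> inv encode_trans) (list_decode d) = list_decode d"
    by (intro map_idI) (metis comp_apply f_inv_into_f rangeI)
  then have "d = list_encode (map encode_trans (map (inv encode_trans) (list_decode d)))"
    by (metis list_decode_inverse map_map)
  then have "n = encode_desc (Desc (list_decode a) (list_decode b) (list_decode c)
      (map (inv encode_trans) (list_decode d)) e (list_decode f))"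
    using n l by (simp add: encode_desc_def del: list_encode.simps)
  then show ?thesis by blast
qed

section \<open>The decision procedure\<close>

definition tape_code :: "nat stksym list \<Rightarrow> nat" where
  "tape_code a = list_encode (map encode_stksym a)"

fun node_code :: "nat \<times> (nat, nat) iconfig \<Rightarrow> nat" where
  "node_code (m, (q, a, b)) = list_encode [m, q, tape_code a, tape_code b]"

text \<open>The fields of \<open>s\<close> are peak, state, and the tapes up to and above the head;
  fields 0, 2 and 4 of \<open>t\<close> are source state, scanned symbol and instruction. The three
  implications are the guards of \<open>apply_instr\<close>: \<open>lcons 1 0\<close> codes
  \<open>[Top]\<close>, demanded by \<open>Stay\<close>, \<open>Pop\<close> and every
  \<open>Push\<close>, and \<open>0\<close> codes \<open>Bot\<close>.\<close>

definition fires :: "nat \<Rightarrow> nat \<Rightarrow> bool" where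
  "fires t s \<longleftrightarrow> lnth s 1 = lnth t 0 \<and> lnth s 2 \<noteq> 0 \<and> lhd (lnth s 2) = lnth t 2 \<and>
     (lnth t 4 = 0 \<or> lnth t 4 = 1 \<or> lnth t 4 \<ge> 5 \<longrightarrow> lnth s 3 = lcons 1 0) \<and>
     (lnth t 4 = 1 \<or> lnth t 4 = 2 \<longrightarrow> lnth t 2 \<noteq> 0) \<and>
     (lnth t 4 = 4 \<longrightarrow> lnth s 3 \<noteq> 0)"

text \<open>\<open>lnth t 4 - 3\<close> turns the code \<open>y + 5\<close> of \<open>Push y\<close> into the code \<open>y + 2\<close> of \<open>Sym y\<close>.\<close>

definition below_code :: "nat \<Rightarrow> nat \<Rightarrow> nat" where
  "below_code t s = (if lnth t 4 = 0 \<or> lnth t 4 = 3 then lnth s 2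
     else if lnth t 4 = 1 \<or> lnth t 4 = 2 then ltl (lnth s 2)
     else if lnth t 4 = 4 then lcons (lhd (lnth s 3)) (lnth s 2)
     else lcons (lnth t 4 - 3) (lnth s 2))"

definition above_code :: "nat \<Rightarrow> nat \<Rightarrow> nat" where
  "above_code t s = (if lnth t 4 = 2 then lcons (lnth t 2) (lnth s 3)
     else if lnth t 4 = 4 then ltl (lnth s 3) else lnth s 3)"

definition peak_code :: "nat \<Rightarrow> nat \<Rightarrow> nat" where
  "peak_code t s = max (lnth s 0) (llen (below_code t s) + llen (above_code t s) - 2)"

definition succ_code :: "nat \<Rightarrow> nat \<Rightarrow> nat" where
  "succ_code t s = lcons (peak_code t s) (lcons (lnth t 3)
     (lcons (below_code t s) (lcons (above_code t s) 0)))"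

lemma computable_below_code [comp_intros]:
  "computable f \<Longrightarrow> computable g \<Longrightarrow> computable (\<lambda>x. below_code (f x) (g x))"
  unfolding below_code_def by (intro comp_intros)

lemma computable_above_code [comp_intros]:
  "computable f \<Longrightarrow> computable g \<Longrightarrow> computable (\<lambda>x. above_code (f x) (g x))"
  unfolding above_code_def by (intro comp_intros)

lemma computable_peak_code [comp_intros]:
  "computable f \<Longrightarrow> computable g \<Longrightarrow> computable (\<lambda>x. peak_code (f x) (g x))"
  unfolding peak_code_def by (intro comp_intros)

lemma computable_succ_code [comp_intros]:
  "computable f \<Longrightarrow> computable g \<Longrightarrow> computable (\<lambda>x. succ_code (f x) (g x))"
  unfolding succ_code_def by (intro comp_intros)

lemma decpred_fires [comp_intros]:
  "computable f \<Longrightarrow> computable g \<Longrightarrow> decpred (\<lambda>x. fires (f x) (g x))"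
  unfolding fires_def by (intro comp_intros)

text \<open>A bound for the number of possible values of \<open>level\<close>, since \<open>n\<close> bounds the numbers of states
  and of stack symbols.\<close>

definition threshold :: "nat \<Rightarrow> nat" where
  "threshold n = 2 ^ (2 ^ (n * n + 4 * n + 1))"

text \<open>The cap on the peak makes the reachable part finite. Peaks never decrease, so a run
  whose final peak is admissible is never cut off.\<close>

definition edge :: "nat \<Rightarrow> nat \<Rightarrow> nat \<Rightarrow> bool" where
  "edge n s s' \<longleftrightarrow> (\<exists>j<llen (lnth n 3). fires (lnth (lnth n 3) j) s \<and>
     peak_code (lnth (lnth n 3) j) s \<le> 2 * threshold n \<and> succ_code (lnth (lnth n 3) j) s = s')"

definition init_code :: "nat \<Rightarrow> nat" where
  "init_code n = lcons 0 (lcons (lnth n 4) (lcons (lcons 0 0) (lcons (lcons 1 0) 0)))"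

definition search_code :: "nat \<Rightarrow> nat \<Rightarrow> bool" where
  "search_code n c \<longleftrightarrow>
     (\<forall>i<llen c. lnth c i = init_code n \<or> (\<exists>k<i. edge n (lnth c k) (lnth c i))) \<and>
     lmem (init_code n) c \<and>
     (\<forall>i<llen c. \<forall>j<llen (lnth n 3). fires (lnth (lnth n 3) j) (lnth c i) \<longrightarrow>
        peak_code (lnth (lnth n 3) j) (lnth c i) \<le> 2 * threshold n \<longrightarrow>
        lmem (succ_code (lnth (lnth n 3) j) (lnth c i)) c)"

text \<open>The implication makes the minimization succeed on every number: if \<open>n\<close> is
  not a valid code, any \<open>c\<close> will do.\<close>

definition search :: "nat \<Rightarrow> nat" where
  "search n = (LEAST c. valid_code n \<longrightarrow> search_code n c)"

text \<open>Only the lower end of the window is tested; the upper end is enforced by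
  \<open>edge\<close>. Fields 5 and 0 of the description list the targets of the two
  measures.\<close>

definition high_run :: "measure_kind \<Rightarrow> nat \<Rightarrow> bool" where
  "high_run z n \<longleftrightarrow> (\<exists>i<llen (search n). threshold n \<le> lnth (lnth (search n) i) 0 \<and>
     lmem (lnth (lnth (search n) i) 1) (lnth n (case z of Accept \<Rightarrow> 5 | Strong \<Rightarrow> 0)))"

lemma search_code_encode:
  "search_code n (list_encode xs) \<longleftrightarrow> enumerates (edge n) (init_code n) xs"
proof -
  have "(\<forall>i<length xs. lnth (list_encode xs) i = s \<or>
      (\<exists>k<i. R (lnth (list_encode xs) k) (lnth (list_encode xs) i))) \<longleftrightarrow>
    (\<forall>i<length xs. xs ! i = s \<or> (\<exists>k<i. R (xs ! k) (xs ! i)))" for R s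
    by (intro all_cong1 imp_cong arg_cong2[where f = "(\<or>)"] ex_cong1 conj_cong refl) simp_all
  moreover have "(\<forall>i<length xs. \<forall>j<llen (lnth n 3).
      fires (lnth (lnth n 3) j) (lnth (list_encode xs) i) \<longrightarrow>
      peak_code (lnth (lnth n 3) j) (lnth (list_encode xs) i) \<le> 2 * threshold n \<longrightarrow>
      succ_code (lnth (lnth n 3) j) (lnth (list_encode xs) i) \<in> set xs) \<longleftrightarrow>
    (\<forall>x\<in>set xs. \<forall>y. edge n x y \<longrightarrow> y \<in> set xs)"
    unfolding all_set_conv_all_nth edge_def by auto
  ultimately show ?thesis
    unfolding search_code_def enumerates_def llen_encode lmem_encode by simp
qed

section \<open>The coded graph is the graph of configurations of bounded peak\<close>

lemma tape_code_simps:
  "tape_code [] = 0" "tape_code (x # a) = lcons (encode_stksym x) (tape_code a)"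
  by (simp_all add: tape_code_def lcons_def)

lemma lcons_simps [simp]: "lhd (lcons x l) = x" "ltl (lcons x l) = l" "lcons x l \<noteq> 0"
  "lcons x l = lcons x' l' \<longleftrightarrow> x = x' \<and> l = l'"
  by (simp_all add: lhd_def ltl_def lcons_def)

lemma llen_tape_code [simp]: "llen (tape_code a) = length a"
  by (simp add: tape_code_def)

lemma tape_code_eq [simp]: "tape_code a = tape_code b \<longleftrightarrow> a = b"
  by (simp add: tape_code_def list_encode_eq inj_map_eq_map[OF inj_encode_stksym])

lemma tape_code_eq_0 [simp]: "tape_code a = 0 \<longleftrightarrow> a = []"
  by (simp add: tape_code_def)

lemma encode_stksym_eq_0 [simp]: "encode_stksym x = 0 \<longleftrightarrow> x = Bot"
  by (cases x) auto

lemma encode_stksym_eq [simp]: "encode_stksym x = encode_stksym y \<longleftrightarrow> x = y"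
  by (simp add: inj_eq[OF inj_encode_stksym])

lemma node_code_fields [simp]:
  "lnth (node_code (m, (q, a, b))) 0 = m"
  "lnth (node_code (m, (q, a, b))) (Suc 0) = q"
  "lnth (node_code (m, (q, a, b))) 2 = tape_code a"
  "lnth (node_code (m, (q, a, b))) 3 = tape_code b"
  by (simp_all del: list_encode.simps)

lemma node_code_lcons:
  "node_code (m, (q, a, b)) = lcons m (lcons q (lcons (tape_code a) (lcons (tape_code b) 0)))"
  by (simp add: lcons_def)

lemma fires_code:
  assumes "t = encode_trans ((q, l, x), (p, i))" "s = node_code (m, (q', a, b))"
  shows "fires t s \<longleftrightarrow> q' = q \<and> a \<noteq> [] \<and> hd a = x \<and> apply_instr i a b \<noteq> None"
    and "fires t s \<Longrightarrow> apply_instr i a b = Some (a', b') \<Longrightarrow>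
      below_code t s = tape_code a' \<and> above_code t s = tape_code b'"
proof -
  have top: "tape_code b = lcons (Suc 0) 0 \<longleftrightarrow> b = [Top]"
    using tape_code_eq[of b "[Top]"] by (simp add: tape_code_simps del: tape_code_eq)
  show "fires t s \<longleftrightarrow> q' = q \<and> a \<noteq> [] \<and> hd a = x \<and> apply_instr i a b \<noteq> None"
    unfolding assms fires_def
    by (cases a; cases i) (auto simp: top tape_code_simps simp del: encode_trans.simps node_code.simps)
  show "below_code t s = tape_code a' \<and> above_code t s = tape_code b'"
    if "fires t s" "apply_instr i a b = Some (a', b')"
    using that unfolding assms below_code_def above_code_def fires_def
    by (cases a; cases b; cases i)
      (auto simp: tape_code_simps split: if_splits simp del: encode_trans.simps node_code.simps)
qed

lemma ex_lnth_map:
  "(\<exists>j<length ts. P (lnth (list_encode (map f ts)) j)) \<longleftrightarrow> (\<exists>t\<in>set ts. P (f t))"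
proof -
  have "(\<exists>j<length ts. P (lnth (list_encode (map f ts)) j)) \<longleftrightarrow> (\<exists>j<length ts. P (f (ts ! j)))"
    by (intro ex_cong1 conj_cong) simp_all
  then show ?thesis using all_set_conv_all_nth[of ts "\<lambda>t. \<not> P (f t)"] by blast
qed

lemma edge_node_code:
  fixes D z
  defines "M \<equiv> sa_of D" and "n \<equiv> encode_desc D"
  assumes "stack_automaton (sa_of D)"
  shows "edge n (node_code (m, c)) s' \<longleftrightarrow> (\<exists>m' c'. s' = node_code (m', c') \<and>
    sa_with_targets.tstep M (m, c) (m', c') \<and> m' \<le> 2 * threshold n)"
proof -
  \<comment> \<open>\<open>tstep\<close> does not involve the targets, so the result applies to both
    measures.\<close>
  interpret sa_with_targets M "targets Accept M" by unfold_locales (use assms in simp)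
  obtain q a b where c: "c = (q, a, b)" by (metis prod_cases3)
  let ?s = "node_code (m, (q, a, b))"
  have trans: "transitions M = set (d_trans D)" by (simp add: M_def sa_of_def)
  have edge: "edge n ?s s' \<longleftrightarrow> (\<exists>t\<in>set (d_trans D). fires (encode_trans t) ?s \<and>
      peak_code (encode_trans t) ?s \<le> 2 * threshold n \<and> succ_code (encode_trans t) ?s = s')"
    unfolding edge_def n_def encode_desc_fields llen_encode length_map
    by (rule ex_lnth_map)
  have succ: "peak_code (encode_trans ((q', l, x), (p, i))) ?s = max m (iconfig_size (p, a', b')) \<and>
     succ_code (encode_trans ((q', l, x), (p, i))) ?s =
       node_code (max m (iconfig_size (p, a', b')), (p, a', b'))"
    if "fires (encode_trans ((q', l, x), (p, i))) ?s" "apply_instr i a b = Some (a', b')"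
    for q' l x p i a' b'
  proof -
    note codes = fires_code(2)[OF refl refl that]
    have "peak_code (encode_trans ((q', l, x), (p, i))) ?s = max m (iconfig_size (p, a', b'))"
      using codes by (simp add: peak_code_def del: encode_trans.simps node_code.simps)
    then show ?thesis
      using codes by (simp add: succ_code_def node_code_lcons[of _ p a' b']
          del: encode_trans.simps node_code.simps)
  qed
  show ?thesis unfolding c
  proof
    assume "edge n ?s s'"
    then obtain q' l x p i where t: "((q', l, x), (p, i)) \<in> set (d_trans D)"
      "fires (encode_trans ((q', l, x), (p, i))) ?s"
      "peak_code (encode_trans ((q', l, x), (p, i))) ?s \<le> 2 * threshold n"
      "succ_code (encode_trans ((q', l, x), (p, i))) ?s = s'" unfolding edge by auto
    then have f: "q = q'" "a \<noteq> []" "hd a = x" and "apply_instr i a b \<noteq> None"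
      using fires_code(1)[OF refl refl] by auto
    then obtain a' b' where ab: "apply_instr i a b = Some (a', b')" by auto
    have "(q, p) \<in> moves (hd a) i" using t(1) f by (auto simp: moves_def trans)
    then have "tstep (m, (q, a, b)) (max m (iconfig_size (p, a', b')), (p, a', b'))"
      using ab f by auto
    then show "\<exists>m' c'. s' = node_code (m', c') \<and> tstep (m, (q, a, b)) (m', c') \<and> m' \<le> 2 * threshold n"
      using succ[OF t(2) ab] t(3,4) by metis
  next
    assume "\<exists>m' c'. s' = node_code (m', c') \<and> tstep (m, (q, a, b)) (m', c') \<and> m' \<le> 2 * threshold n"
    then obtain m' p a' b' where s': "s' = node_code (m', (p, a', b'))"
      "tstep (m, (q, a, b)) (m', (p, a', b'))" "m' \<le> 2 * threshold n" by (metis prod_cases3)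
    then obtain i where i: "a \<noteq> []" "(q, p) \<in> moves (hd a) i" "apply_instr i a b = Some (a', b')"
      "m' = max m (iconfig_size (p, a', b'))" by auto
    then obtain l where l: "((q, l, hd a), (p, i)) \<in> set (d_trans D)"
      by (auto simp: moves_def trans)
    have f: "fires (encode_trans ((q, l, hd a), (p, i))) ?s"
      using fires_code(1)[OF refl refl] i by simp
    show "edge n ?s s'" unfolding edge
      using l f succ[OF f i(3)] s' i(4) by metis
  qed
qed

lemma length_le_list_encode: "length xs \<le> list_encode xs"
  by (induction xs) (auto intro: le_trans[OF _ le_prod_encode_2])

lemma le_list_encode: "x \<in> set xs \<Longrightarrow> x \<le> list_encode xs"
proof (induction xs)
  case (Cons y xs)
  then show ?case using le_prod_encode_1[of y "list_encode xs"] le_prod_encode_2[of "list_encode xs" y]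
    by auto
qed simp

lemma reachable_codes:
  fixes D z
  defines "M \<equiv> sa_of D" and "n \<equiv> encode_desc D"
  assumes "stack_automaton (sa_of D)"
  shows "{s. (edge n)\<^sup>*\<^sup>* (init_code n) s} = node_code ` {(m, c).
    (sa_with_targets.tstep M)\<^sup>*\<^sup>* (0, (init M, [Bot], [Top])) (m, c) \<and> m \<le> 2 * threshold n}"
proof -
  interpret sa_with_targets M "targets Accept M" by unfold_locales (use assms in simp)
  note edge = edge_node_code[OF assms(3), folded M_def n_def]
  have init: "init_code n = node_code (0, (init M, [Bot], [Top]))"
    by (simp add: init_code_def node_code_lcons tape_code_simps M_def n_def sa_of_def
        del: node_code.simps)
  have "\<exists>m c. s = node_code (m, c) \<and> nreach m c \<and> m \<le> 2 * threshold n"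
    if "(edge n)\<^sup>*\<^sup>* (init_code n) s" for s
    using that
  proof (induction rule: rtranclp_induct)
    case base
    then show ?case unfolding init by blast
  next
    case (step s s')
    then obtain m c where s: "s = node_code (m, c)" "nreach m c" by blast
    obtain m' c' where "s' = node_code (m', c')" "tstep (m, c) (m', c')" "m' \<le> 2 * threshold n"
      using step.hyps(2) unfolding s(1) edge by blast
    then show ?case using rtranclp.rtrancl_into_rtrancl[OF s(2)] by blast
  qed
  moreover have "(edge n)\<^sup>*\<^sup>* (init_code n) (node_code (m, c))" if "nreach m c" "m \<le> 2 * threshold n" for m c
    using that
  proof (induction rule: rtranclp_induct2)
    case refl
    then show ?case by (simp add: init del: node_code.simps)
  next
    case (step m c m' c')
    have "m \<le> m'" using step.hyps(2) by simp
    moreover have "edge n (node_code (m, c)) (node_code (m', c'))"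
      unfolding edge using step by blast
    moreover have "(edge n)\<^sup>*\<^sup>* (init_code n) (node_code (m, c))"
      using step.IH step.prems \<open>m \<le> m'\<close> by linarith
    ultimately show ?case by (meson rtranclp.rtrancl_into_rtrancl)
  qed
  ultimately show ?thesis by blast
qed

lemma finite_reachable_codes:
  assumes valid: "stack_automaton (sa_of D)"
  shows "finite {s. (edge (encode_desc D))\<^sup>*\<^sup>* (init_code (encode_desc D)) s}"
proof -
  define M where "M = sa_of D"
  interpret sa_with_targets M "targets Accept M" by unfold_locales (use valid M_def in simp)
  let ?K = "2 * threshold (encode_desc D)"
  \<comment> \<open>The summand 2 accounts for the two markers, which the stack size does not
    count.\<close>
  let ?L = "{xs. set xs \<subseteq> stack_alphabet M \<and> length xs \<le> ?K + 2}"
  have "finite (stack_alphabet M)" "finite Q"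
    using valid unfolding M_def by (auto simp: stack_automaton_def stack_alphabet_def)
  then have fin: "finite ({..?K} \<times> Q \<times> ?L \<times> ?L)"
    by (intro finite_cartesian_product finite_lists_length_le) auto
  have "(m, c) \<in> {..?K} \<times> Q \<times> ?L \<times> ?L" if "nreach m c" "m \<le> ?K" for m c
  proof -
    obtain q a b where c: "c = (q, a, b)" by (metis prod_cases3)
    have "rev a @ b \<in> stacks M" using computation_if_nreach that(1) c by blast
    then obtain g where "rev a @ b = Bot # map Sym g @ [Top]" "set g \<subseteq> stack0 M"
      unfolding stacks_def by auto
    then have "set (rev a @ b) \<subseteq> stack_alphabet M"
      by (simp only:) (auto simp: stack_alphabet_def)
    moreover have "length a + length b \<le> m + 2" using nreach_size[OF that(1)] c by simp
    ultimately show ?thesis using nreach_states[OF that(1)[unfolded c]] that(2) c by auto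
  qed
  then have "{(m, c). nreach m c \<and> m \<le> ?K} \<subseteq> {..?K} \<times> Q \<times> ?L \<times> ?L" by blast
  then show ?thesis unfolding reachable_codes[OF valid] M_def[symmetric]
    using fin finite_subset by blast
qed

lemma search_total: "\<exists>c. valid_code n \<longrightarrow> search_code n c"
proof (cases "valid_code n")
  case True
  then obtain D where D: "n = encode_desc D" using valid_code_desc by blast
  then have "stack_automaton (sa_of D)" using True valid_code_encode by blast
  then obtain xs where "enumerates (edge n) (init_code n) xs"
    using ex_enumerates[OF finite_reachable_codes] D by blast
  then have "search_code n (list_encode xs)" by (simp only: search_code_encode)
  then show ?thesis by blast
qed simp

lemma computable_threshold [comp_intros]: "computable f \<Longrightarrow> computable (\<lambda>x. threshold (f x))"
  unfolding threshold_def by (intro comp_intros)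

lemma decpred_search_code: "decpred (\<lambda>z. search_code (psnd z) (pfst z))"
  unfolding search_code_def edge_def init_code_def by (intro comp_intros)

lemma computable_search [comp_intros]: "computable search"
  unfolding search_def
  by (rule computable_Least) (intro comp_intros decpred_search_code search_total)+

lemma decpred_high_run: "decpred (high_run z)"
  unfolding high_run_def by (intro comp_intros computable_compose[OF computable_search])

lemma high_run_iff:
  assumes valid: "stack_automaton (sa_of D)"
  shows "high_run z (encode_desc D) \<longleftrightarrow> \<not> enat_bigo (sa_space z (sa_of D)) (\<lambda>n. 1)"
proof -
  define M where "M = sa_of D"
  define n where "n = encode_desc D"
  interpret sa_with_targets M "targets z M" by unfold_locales (use valid M_def in simp)
  have "search_code n (search n)"
    using LeastI_ex[OF search_total[of n]] valid_code_encode valid unfolding search_def n_def by blast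
  moreover obtain xs where xs: "search n = list_encode xs" by (metis list_decode_inverse)
  ultimately have set: "set xs = node_code ` {(m, c). nreach m c \<and> m \<le> 2 * threshold n}"
    using set_enumerates search_code_encode reachable_codes[OF valid, folded M_def n_def] by metis
  have fin: "lmem q (lnth n (case z of Accept \<Rightarrow> 5 | Strong \<Rightarrow> 0)) \<longleftrightarrow> q \<in> targets z M" for q
    by (cases z) (simp_all add: n_def targets_def M_def sa_of_def)
  have "high_run z n \<longleftrightarrow> (\<exists>s\<in>set xs. threshold n \<le> lnth s 0 \<and> lnth s 1 \<in> targets z M)"
    unfolding high_run_def xs fin using all_set_conv_all_nth[of xs "\<lambda>s. \<not> (threshold n \<le> lnth s 0 \<and> lnth s 1 \<in> targets z M)"]
    by auto
  also have "\<dots> \<longleftrightarrow> (\<exists>m c. threshold n \<le> m \<and> m \<le> 2 * threshold n \<and> nreach m c \<and> fst c \<in> targets z M)"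
    unfolding set by (force simp del: node_code.simps)
  also have "\<dots> \<longleftrightarrow> (\<forall>B. \<exists>m>B. \<exists>c. nreach m c \<and> fst c \<in> targets z M)"
  proof (rule unbounded_iff[symmetric])
    have "list_encode (d_states D) \<le> n" "list_encode (d_stack0 D) \<le> n"
      unfolding n_def encode_desc_def by (rule le_list_encode; simp)+
    then have "card (set (d_states D)) \<le> n" "card (set (d_stack0 D)) \<le> n"
      using length_le_list_encode card_length by (metis le_trans)+
    then show "2 ^ card universe \<le> threshold n"
      using card_universe_le[of n] unfolding threshold_def M_def sa_of_def
      by (intro power_increasing) auto
  qed
  also have "\<dots> \<longleftrightarrow> \<not> enat_bigo (sa_space z M) (\<lambda>n. 1)"
    using bounded_space_iff[OF refl] by blast
  finally show ?thesis unfolding n_def M_def .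
qed

theorem proposition17:
  fixes z :: measure_kind
  shows "decidable {encode_desc D | D.
           stack_automaton (sa_of D) \<and> enat_bigo (sa_space z (sa_of D)) (\<lambda>n. 1)}"
proof -
  have "decidable {n. valid_code n \<and> \<not> high_run z n}"
    by (intro decidable_if_decpred comp_intros decpred_high_run)
  also have "{n. valid_code n \<and> \<not> high_run z n} = {encode_desc D | D.
      stack_automaton (sa_of D) \<and> enat_bigo (sa_space z (sa_of D)) (\<lambda>n. 1)}"
    using valid_code_desc valid_code_encode high_run_iff by blast
  finally show ?thesis .
qed

end
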